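(* Let $p=(p_0,p_1,\ldots)$ be a critical offspring distribution (mean $\mu=1$, $p_1\neq 1$), let $\tau$ be a Galton-Watson tree with offspring distribution $p$, and let $\tau^*$ be the immortal tree associated with $p$. Let $W(\mathbf{t})=\sup_{b\in\mathbb{Z}_+}Y_b(\mathbf{t})$ be the width of a tree. Then, as $n\to\infty$, $$\mathrm{dist}(\tau\mid W(\tau)>n)\to\mathrm{dist}(\tau^* ).$$
   Context: $\mathbb{Z}_+=\{0,1,2,\ldots\}$, $\mathbb{N}=\{1,2,\ldots\}$. Trees are rooted ordered trees in Neveu's formalism: a tree $\mathbf{t}$ is a set of finite sequences of positive integers containing the empty sequence $\emptyset$ (the root), closed under taking prefixes, such that for each $u\in\mathbf{t}$ there is $k_u(\mathbf{t})\in\mathbb{Z}_+$ (the out-degree) with $ui\in\mathbf{t}$ iff $1\le i\le k_u(\mathbf{t})$. $|u|$ is the length (height) of $u$; $Y_b(\mathbf{t})$ is the number of nodes of $\mathbf{t}$ at height $b$. $\mathbb{T}$ is the set of trees, $\mathbb{T}^{(h)}$ the set of trees all of whose nodes have height at most $h$, and $r_h(\mathbf{t})=\{u\in\mathbf{t}:|u|\le h\}$. Convergence in distribution of $\mathbb{T}$-valued random variables is with respect to the distance $d(\mathbf{t},\mathbf{t}')=2^{-\sup\{h\in\mathbb{Z}_+:r_h(\mathbf{t})=r_h(\mathbf{t}')\}}$; equivalently, $T_n\to T$ in distribution iff $\mathbf{P}[r_h(T_n)=\mathbf{t}]\to\mathbf{P}[r_h(T)=\mathbf{t}]$ for all $h\in\mathbb{N}$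 and $\mathbf{t}\in\mathbb{T}^{(h)}$. A Galton-Watson tree $\tau$ with offspring distribution $p$ is a random tree in which the out-degree of the root has law $p$ and, conditionally on it being $n$, the $n$ subtrees rooted at the children of the root are independent and distributed as $\tau$. The immortal tree $\tau^*$ of $p$: nodes are normal or special; the root is special; normal nodes have offspring distribution $p$, special nodes have the size-biased offspring distribution $\hat p_k=kp_k/\mu$; the offspring numbers of all nodes are independent; all children of a normal node are normal; among the children of a special node one chosen uniformly at random is special and the others are normal. *)

theory Defs
  imports "HOL-Probability.Probability"
begin

section \<open>Rooted ordered trees in Neveu's formalism\<close>

definition is_tree :: "nat list set \<Rightarrow> bool" where
  "is_tree t \<longleftrightarrow>
     t \<subseteq> lists {1..} \<and> [] \<in> t \<and>
     (\<forall>u v. u @ v \<in> t \<longrightarrow> u \<in> t) \<and>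
     (\<forall>u\<in>t. \<exists>k. \<forall>i. u @ [i] \<in> t \<longleftrightarrow> 1 \<le> i \<and> i \<le> k)"

lemma is_tree_root: "is_tree {[]}"
  unfolding is_tree_def by (auto intro: exI[of _ 0])

typedef tree = "{t. is_tree t}" morphisms nodes Tree
  using is_tree_root by blast

setup_lifting type_definition_tree

definition out_degree :: "nat list \<Rightarrow> tree \<Rightarrow> nat" where
  "out_degree u t = (THE k. \<forall>i. u @ [i] \<in> nodes t \<longleftrightarrow> 1 \<le> i \<and> i \<le> k)"

definition level_size :: "nat \<Rightarrow> tree \<Rightarrow> nat" where
  "level_size b t = card {u \<in> nodes t. length u = b}"

text \<open>Trees may be infinite, so the width can be infinite.\<close>

definition width :: "tree \<Rightarrow> enat" where
  "width t = (SUP b. enat (level_size b t))"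

lift_definition truncate :: "nat \<Rightarrow> tree \<Rightarrow> tree"
  is "\<lambda>h t. {u \<in> t. length u \<le> h}"
proof -
  fix h :: nat and t assume "is_tree t"
  then have t: "t \<subseteq> lists {1..}" "[] \<in> t" "\<And>u v. u @ v \<in> t \<Longrightarrow> u \<in> t"
    "\<And>u. u \<in> t \<Longrightarrow> \<exists>k. \<forall>i. u @ [i] \<in> t \<longleftrightarrow> 1 \<le> i \<and> i \<le> k"
    unfolding is_tree_def by blast+
  let ?s = "{u \<in> t. length u \<le> h}"
  have 1: "?s \<subseteq> lists {1..}" using t(1) by blast
  have 2: "[] \<in> ?s" using t(2) by simp
  have 3: "\<forall>u v. u @ v \<in> ?s \<longrightarrow> u \<in> ?s" using t(3) by auto
  have 4: "\<forall>u\<in>?s. \<exists>k. \<forall>i. u @ [i] \<in> ?s \<longleftrightarrow> 1 \<le> i \<and> i \<le> k"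
  proof
    fix u assume u: "u \<in> ?s"
    show "\<exists>k. \<forall>i. u @ [i] \<in> ?s \<longleftrightarrow> 1 \<le> i \<and> i \<le> k"
    proof (cases "length u < h")
      case True
      then show ?thesis using t(4)[of u] u by simp
    next
      case False
      then show ?thesis by (intro exI[of _ 0]) auto
    qed
  qed
  show "is_tree ?s"
    unfolding is_tree_def by (intro conjI 1 2 3 4)
qed

text \<open>The subtree of \<open>t\<close> rooted at \<open>u\<close>; the value for \<open>u\<close> outside \<open>t\<close> is a mere convention.\<close>

lift_definition subtree :: "nat list \<Rightarrow> tree \<Rightarrow> tree"
  is "\<lambda>u t. if u \<in> t then {v. u @ v \<in> t} else {[]}"
proof -
  fix u :: "nat list" and t assume t: "is_tree t"
  show "is_tree (if u \<in> t then {v. u @ v \<in> t} else {[]})"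
  proof (cases "u \<in> t")
    case True
    have 1: "v \<in> lists {1..}" if "u @ v \<in> t" for v
      using t that unfolding is_tree_def by (metis append_in_lists_conv subsetD)
    have 2: "u @ v \<in> t" if "u @ v @ w \<in> t" for v w
      using t that unfolding is_tree_def by (metis append.assoc)
    have 3: "\<exists>k. \<forall>i. u @ v @ [i] \<in> t \<longleftrightarrow> 1 \<le> i \<and> i \<le> k" if "u @ v \<in> t" for v
      using t that unfolding is_tree_def by (metis append.assoc)
    show ?thesis
      using True 1 2 3 unfolding is_tree_def by (simp add: subset_iff)
  next
    case False
    then show ?thesis by (simp add: is_tree_root)
  qed
qed


section \<open>The metric on trees\<close>

lemma truncate_truncate: "truncate h (truncate k t) = truncate (min h k) t"
  by transfer auto

lemma truncate_eq_mono:
  "truncate h t = truncate h t' \<Longrightarrow> k \<le> h \<Longrightarrow> truncate k t = truncate k t'"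
  using truncate_truncate[of k h t] truncate_truncate[of k h t'] by (simp add: min_def)

lemma truncate_0: "truncate 0 t = truncate 0 t'"
  by transfer (auto simp: is_tree_def)

lemma truncate_eq_imp_eq:
  assumes "\<And>h. truncate h t = truncate h t'" shows "t = t'"
proof -
  have "u \<in> nodes t \<longleftrightarrow> u \<in> nodes t'" for u
  proof -
    have "nodes (truncate (length u) t) = nodes (truncate (length u) t')"
      using assms by simp
    then show ?thesis unfolding truncate.rep_eq by auto
  qed
  then show ?thesis by (simp add: nodes_inject[symmetric] set_eq_iff)
qed

lemma finite_truncate_eq:
  assumes "t \<noteq> t'" shows "finite {h. truncate h t = truncate h t'}"
proof -
  obtain k where k: "truncate k t \<noteq> truncate k t'"
    using truncate_eq_imp_eq assms by blast
  have "h < k" if "truncate h t = truncate h t'" for h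
  proof (rule ccontr)
    assume "\<not> h < k"
    then have "k \<le> h" by simp
    with that have "truncate k t = truncate k t'" by (rule truncate_eq_mono)
    with k show False by contradiction
  qed
  then have "{h. truncate h t = truncate h t'} \<subseteq> {..<k}" by blast
  then show ?thesis by (rule finite_subset) simp
qed

text \<open>
  The distance is \<open>2\<close> to the power minus the supremum of the levels up to which two trees agree.
  For equal trees the supremum is infinite and the distance is \<open>0\<close>; otherwise the set is finite
  and nonempty.
\<close>

instantiation tree :: metric_space
begin

definition dist_tree :: "tree \<Rightarrow> tree \<Rightarrow> real" where
  "dist_tree t t' =
     (if t = t' then 0 else 1 / 2 ^ Sup {h::nat. truncate h t = truncate h t'})"

definition uniformity_tree :: "(tree \<times> tree) filter" where
  "uniformity_tree = (INF e\<in>{0<..}. principal {(x, y). dist x y < e})"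

definition open_tree :: "tree set \<Rightarrow> bool" where
  "open_tree U \<longleftrightarrow> (\<forall>x\<in>U. eventually (\<lambda>(x', y). x' = x \<longrightarrow> y \<in> U) uniformity)"

instance
proof
  show "dist x y = 0 \<longleftrightarrow> x = y" for x y :: tree
    by (simp add: dist_tree_def)
  show "dist x y \<le> dist x z + dist y z" for x y z :: tree
  proof -
    define S where "S a b = {h::nat. truncate h a = truncate h b}" for a b :: tree
    have d: "dist a b = (if a = b then 0 else 1 / 2 ^ Sup (S a b))" for a b :: tree
      unfolding dist_tree_def S_def ..
    have fin: "finite (S a b)" if "a \<noteq> b" for a b
      using finite_truncate_eq[OF that] by (simp add: S_def)
    have ne: "S a b \<noteq> {}" for a b
      using truncate_0[of a b] unfolding S_def by blast
    have mem: "Sup (S a b) \<in> S a b" if "a \<noteq> b" for a b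
      using Max_in[OF fin[OF that] ne] by (simp add: Sup_nat_def ne)
    show ?thesis
    proof (cases "x = y \<or> x = z \<or> y = z")
      case True
      have "S x y = S y x" unfolding S_def by (simp only: eq_commute)
      with True show ?thesis by (auto simp: d)
    next
      case False
      define m where "m = min (Sup (S x z)) (Sup (S y z))"
      have "truncate m x = truncate m z" "truncate m y = truncate m z"
        using mem[of x z] mem[of y z] False truncate_eq_mono[of _ x z m]
          truncate_eq_mono[of _ y z m]
        unfolding S_def m_def by simp_all
      then have "m \<in> S x y" by (simp add: S_def)
      then have le: "m \<le> Sup (S x y)"
        using Max_ge[OF fin[of x y]] False by (simp add: Sup_nat_def ne)
      have "dist x y \<le> 1 / 2 ^ m"
        using False le by (simp add: d field_simps)
      also have "\<dots> \<le> dist x z + dist y z"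
        using False by (simp add: d m_def min_def)
      finally show ?thesis .
    qed
  qed
qed (simp_all add: uniformity_tree_def open_tree_def)

end


section \<open>Convergence in distribution\<close>

definition converges_in_law ::
    "(nat \<Rightarrow> 'a::metric_space measure) \<Rightarrow> 'a measure \<Rightarrow> bool" where
  "converges_in_law Q Q' \<longleftrightarrow>
     (\<forall>f::'a \<Rightarrow> real. continuous_on UNIV f \<longrightarrow> bounded (range f) \<longrightarrow>
        (\<lambda>n. integral\<^sup>L (Q n) f) \<longlonglongrightarrow> integral\<^sup>L Q' f)"


section \<open>Galton-Watson trees\<close>

definition offspring_mean :: "nat pmf \<Rightarrow> real" where
  "offspring_mean p = measure_pmf.expectation p real"

definition critical :: "nat pmf \<Rightarrow> bool" where
  "critical p \<longleftrightarrow> integrable (measure_pmf p) real \<and> offspring_mean p = 1 \<and> pmf p 1 \<noteq> 1"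

text \<open>
  \<open>uniform_measure M A\<close> is the conditional probability measure of \<open>M\<close> given the event \<open>A\<close>;
  the root degrees \<open>n\<close> conditioned on are those of positive probability.
\<close>

definition galton_watson_tree :: "nat pmf \<Rightarrow> 'w measure \<Rightarrow> ('w \<Rightarrow> tree) \<Rightarrow> bool" where
  "galton_watson_tree p M \<tau> \<longleftrightarrow>
     prob_space M \<and> \<tau> \<in> borel_measurable M \<and>
     distr M (count_space UNIV) (\<lambda>\<omega>. out_degree [] (\<tau> \<omega>)) = measure_pmf p \<and>
     (\<forall>n\<in>set_pmf p.
        let N = uniform_measure M {\<omega> \<in> space M. out_degree [] (\<tau> \<omega>) = n} in
        prob_space.indep_vars N (\<lambda>_. borel) (\<lambda>i \<omega>. subtree [i] (\<tau> \<omega>)) {1..n} \<and>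
        (\<forall>i\<in>{1..n}. distr N borel (\<lambda>\<omega>. subtree [i] (\<tau> \<omega>)) = distr M borel \<tau>))"


section \<open>The immortal tree\<close>

definition size_biased :: "nat pmf \<Rightarrow> nat pmf" where
  "size_biased p = embed_pmf (\<lambda>k. real k * pmf p k / offspring_mean p)"

text \<open>
  The tree is built from independent marks, one for every possible node. The mark
  \<open>(k, l, c)\<close> of \<open>u\<close> says that \<open>u\<close> has \<open>k\<close> children if it is normal, and
  \<open>l\<close> children, of which number \<open>c\<close> is special, if it is special. Only the part belonging to
  the actual type of \<open>u\<close> is used. The size-biased distribution does not charge \<open>0\<close>, so the
  uniform distribution on \<open>{1..l}\<close> is only used for nonempty \<open>{1..l}\<close>.
\<close>

definition mark_pmf :: "nat pmf \<Rightarrow> (nat \<times> nat \<times> nat) pmf" where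
  "mark_pmf p =
     pair_pmf p (bind_pmf (size_biased p) (\<lambda>l. map_pmf (Pair l) (pmf_of_set {1..l})))"

datatype node_type = Normal | Special

inductive has_type :: "(nat list \<Rightarrow> nat \<times> nat \<times> nat) \<Rightarrow> nat list \<Rightarrow> node_type \<Rightarrow> bool"
  for m where
  root: "has_type m [] Special"
| child_of_normal:
    "has_type m u Normal \<Longrightarrow> m u = (k, l, c) \<Longrightarrow> 1 \<le> i \<Longrightarrow> i \<le> k \<Longrightarrow>
     has_type m (u @ [i]) Normal"
| child_of_special:
    "has_type m u Special \<Longrightarrow> m u = (k, l, c) \<Longrightarrow> 1 \<le> i \<Longrightarrow> i \<le> l \<Longrightarrow>
     has_type m (u @ [i]) (if i = c then Special else Normal)"

lemma has_type_snoc: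
  "has_type m (u @ [i]) x \<longleftrightarrow>
     has_type m u Normal \<and> 1 \<le> i \<and> i \<le> fst (m u) \<and> x = Normal \<or>
     has_type m u Special \<and> 1 \<le> i \<and> i \<le> fst (snd (m u)) \<and>
       x = (if i = snd (snd (m u)) then Special else Normal)"
  (is "?L \<longleftrightarrow> ?R")
proof
  show "?L \<Longrightarrow> ?R" by (cases rule: has_type.cases) auto
  obtain k l c where m: "m u = (k, l, c)" by (cases "m u")
  assume ?R
  then show ?L
  proof (elim disjE conjE)
    assume "has_type m u Normal" "1 \<le> i" "i \<le> fst (m u)" "x = Normal"
    then show ?L using has_type.child_of_normal[of m u k l c i] m by simp
  next
    assume "has_type m u Special" "1 \<le> i" "i \<le> fst (snd (m u))"
      "x = (if i = snd (snd (m u)) then Special else Normal)"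
    then show ?L using has_type.child_of_special[of m u k l c i] m by simp
  qed
qed

lemma has_type_unique: "has_type m u x \<Longrightarrow> has_type m u y \<Longrightarrow> x = y"
proof (induction u arbitrary: x y rule: rev_induct)
  case Nil
  then show ?case by (auto elim: has_type.cases)
next
  case (snoc i u)
  have "\<not> (has_type m u Normal \<and> has_type m u Special)"
    using snoc.IH[of Normal Special] by blast
  with snoc.prems show ?case unfolding has_type_snoc by blast
qed

lift_definition marked_tree :: "(nat list \<Rightarrow> nat \<times> nat \<times> nat) \<Rightarrow> tree"
  is "\<lambda>m. {u. \<exists>x. has_type m u x}"
proof -
  fix m :: "nat list \<Rightarrow> nat \<times> nat \<times> nat"
  let ?t = "{u. \<exists>x. has_type m u x}"
  have "u \<in> lists {1..}" if "has_type m u x" for u x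
    using that by induction auto
  then have 1: "?t \<subseteq> lists {1..}" by blast
  have 2: "[] \<in> ?t" using has_type.root by blast
  have "u \<in> ?t" if "u @ v \<in> ?t" for u v
    using that
  proof (induction v rule: rev_induct)
    case (snoc i v)
    then have "u @ v \<in> ?t"
      using has_type_snoc[of m "u @ v" i] by auto
    then show ?case by (rule snoc.IH)
  qed simp
  then have 3: "\<forall>u v. u @ v \<in> ?t \<longrightarrow> u \<in> ?t" by iprover
  have 4: "\<forall>u\<in>?t. \<exists>k. \<forall>i. u @ [i] \<in> ?t \<longleftrightarrow> 1 \<le> i \<and> i \<le> k"
  proof
    fix u assume "u \<in> ?t"
    then obtain x where x: "has_type m u x" by blast
    show "\<exists>k. \<forall>i. u @ [i] \<in> ?t \<longleftrightarrow> 1 \<le> i \<and> i \<le> k"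
    proof (cases x)
      case Normal
      then have "has_type m u Normal" "\<not> has_type m u Special"
        using x has_type_unique by blast+
      then show ?thesis by (auto simp: has_type_snoc intro!: exI[of _ "fst (m u)"])
    next
      case Special
      then have "has_type m u Special" "\<not> has_type m u Normal"
        using x has_type_unique by blast+
      then show ?thesis by (auto simp: has_type_snoc intro!: exI[of _ "fst (snd (m u))"])
    qed
  qed
  show "is_tree ?t"
    unfolding is_tree_def by (intro conjI 1 2 3 4)
qed

definition immortal_law :: "nat pmf \<Rightarrow> tree measure" where
  "immortal_law p = distr (PiM UNIV (\<lambda>_. measure_pmf (mark_pmf p))) borel marked_tree"

end

theory Submission
  imports Defs
begin

text \<open>
  Write \<open>r\<^sub>h\<close> for truncation at height \<open>h\<close>, \<open>w\<^sub>h(t)\<close> for the product of \<open>pmf p (k\<^sub>u(t))\<close> over the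
  nodes \<open>u\<close> of \<open>t\<close> below height \<open>h\<close>, and \<open>v\<^sub>n\<close> for the probability that a Galton-Watson tree has
  width greater than \<open>n\<close>. Then \<open>P(r\<^sub>h(\<tau>) = r\<^sub>h(t)) = w\<^sub>h(t)\<close> (\<open>prob_cell\<close>). Given this
  event, \<open>Y\<^sub>h(t)\<close> independent copies of \<open>\<tau>\<close> grow from the nodes at height \<open>h\<close>, and the width of
  \<open>\<tau>\<close> is at least the width of each copy; by induction on \<open>h\<close>, splitting at the root,
  \<open>P(r\<^sub>h(\<tau>) = r\<^sub>h(t), W(\<tau>) > n) \<ge> w\<^sub>h(t) (1 - (1 - v\<^sub>n)\<^sup>Y)\<close> with \<open>Y = Y\<^sub>h(t)\<close>
  (\<open>prob_cell_width_gr_ge\<close>).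

  A critical tree has finite width almost surely: the width is finite exactly if the widths of all
  subtrees at the children of the root are finite, so the probability \<open>q\<close> of finite width is a
  fixed point of the generating function of \<open>p\<close>, and strictness in Bernoulli's inequality forces
  \<open>q = 1\<close> (\<open>prob_width_infinite\<close>). Hence \<open>v\<^sub>n\<close> tends to \<open>0\<close>, while \<open>v\<^sub>n > 0\<close> because a complete
  tree of out-degree at least \<open>2\<close> can occur up to any height. Dividing by \<open>v\<^sub>n\<close>,
  \<open>liminf P(r\<^sub>h(\<tau>) = r\<^sub>h(t) | W(\<tau>) > n) \<ge> Y\<^sub>h(t) w\<^sub>h(t)\<close>.

  For the immortal tree the size-biased weight of a special node, multiplied by the probability of
  choosing a prescribed child, is again the weight under \<open>p\<close>. The union bound over the possible
  special nodes at height \<open>h\<close> gives \<open>P(r\<^sub>h(\<tau>\<^sup>*) = r\<^sub>h(t)) \<le> Y\<^sub>h(t) w\<^sub>h(t)\<close>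
  (\<open>emeasure_immortal_cell_le\<close>). So the cells \<open>{s. r\<^sub>h(s) = r\<^sub>h(t)}\<close> satisfy the one-sided
  inequality in the limit. Since all measures involved have mass \<open>1\<close> and the truncations at a
  given height are countably many, Fatou's lemma turns these inequalities into convergence in law
  (\<open>converges_in_law_if_cells\<close>); an upper bound on the conditional probabilities is not needed.
\<close>

section \<open>Nodes, levels and width\<close>

lemma nodes_is_tree: "is_tree (nodes t)"
  using nodes[of t] by simp

lemma root_in_nodes [simp]: "[] \<in> nodes t"
  using nodes_is_tree[of t] unfolding is_tree_def by blast

lemma nodes_prefix: "u @ v \<in> nodes t \<Longrightarrow> u \<in> nodes t"
  using nodes_is_tree[of t] unfolding is_tree_def by blast

lemma out_degree_eqI:
  assumes "\<And>i. u @ [i] \<in> nodes t \<longleftrightarrow> 1 \<le> i \<and> i \<le> k"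
  shows "out_degree u t = k"
  unfolding out_degree_def
proof (rule the_equality)
  fix k' assume k': "\<forall>i. u @ [i] \<in> nodes t \<longleftrightarrow> 1 \<le> i \<and> i \<le> k'"
  have "i \<in> {1..k'} \<longleftrightarrow> i \<in> {1..k}" for i
    unfolding atLeastAtMost_iff using k' assms by blast
  then have "{1..k'} = {1..k}" by blast
  then have "card {1..k'} = card {1..k}" by (rule arg_cong)
  then show "k' = k" by simp
qed (use assms in blast)

lemma child_in_nodes_iff:
  assumes "u \<in> nodes t"
  shows "u @ [i] \<in> nodes t \<longleftrightarrow> 1 \<le> i \<and> i \<le> out_degree u t"
proof -
  obtain k where k: "\<And>i. u @ [i] \<in> nodes t \<longleftrightarrow> 1 \<le> i \<and> i \<le> k"
    using nodes_is_tree[of t] assms unfolding is_tree_def by blast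
  then show ?thesis
    using out_degree_eqI[of u t k] by blast
qed

lemma singleton_in_nodes_iff: "[i] \<in> nodes t \<longleftrightarrow> i \<in> {1..out_degree [] t}"
  using child_in_nodes_iff[of "[]" t i] by simp

lemma Cons_in_nodesD: "i # u \<in> nodes t \<Longrightarrow> i \<in> {1..out_degree [] t}"
  using nodes_prefix[of "[i]" u t] singleton_in_nodes_iff[of i t] by simp

lemma nodes_subtree:
  "i \<in> {1..out_degree [] t} \<Longrightarrow> nodes (subtree [i] t) = {u. i # u \<in> nodes t}"
  using singleton_in_nodes_iff[of i t] by (simp add: subtree.rep_eq)

lemma nodes_conv_subtrees:
  "nodes t = insert [] (\<Union>i\<in>{1..out_degree [] t}. (#) i ` nodes (subtree [i] t))"
    (is "_ = ?R")
proof (intro set_eqI)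
  fix u show "u \<in> nodes t \<longleftrightarrow> u \<in> ?R"
  proof (cases u)
    case (Cons i v)
    have "u \<in> nodes t \<longleftrightarrow> i \<in> {1..out_degree [] t} \<and> v \<in> nodes (subtree [i] t)"
      unfolding Cons using Cons_in_nodesD[of i v t] nodes_subtree[of i t] by blast
    then show ?thesis
      unfolding Cons by blast
  qed simp
qed

lemma out_degree_subtree:
  "i \<in> {1..out_degree [] t} \<Longrightarrow> out_degree u (subtree [i] t) = out_degree (i # u) t"
  unfolding out_degree_def by (simp add: nodes_subtree[unfolded out_degree_def])

lemma finite_nodes_le: "finite {u \<in> nodes t. length u \<le> h}"
proof (induction h arbitrary: t)
  case 0
  show ?case by (rule finite_subset[of _ "{[]}"]) auto
next
  case (Suc h)
  have "{u \<in> nodes t. length u \<le> Suc h} \<subseteq>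
    insert [] (\<Union>i\<in>{1..out_degree [] t}. (#) i ` {u \<in> nodes (subtree [i] t). length u \<le> h})"
    by (subst nodes_conv_subtrees) auto
  then show ?case
    by (rule finite_subset) (use Suc.IH in simp)
qed

lemma finite_nodes_less: "finite {u \<in> nodes t. length u < h}"
  by (rule finite_subset[OF _ finite_nodes_le[of t h]]) auto

lemma finite_level: "finite {u \<in> nodes t. length u = b}"
  by (rule finite_subset[OF _ finite_nodes_le[of t b]]) auto

lemma level_size_0 [simp]: "level_size 0 t = 1"
proof -
  have "{u \<in> nodes t. length u = 0} = {[]}" by auto
  then show ?thesis by (simp add: level_size_def)
qed

lemma level_size_Suc:
  "level_size (Suc b) t = (\<Sum>i\<in>{1..out_degree [] t}. level_size b (subtree [i] t))"
proof -
  have "{u \<in> nodes t. length u = Suc b} =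
    (\<Union>i\<in>{1..out_degree [] t}. (#) i ` {u \<in> nodes (subtree [i] t). length u = b})"
    by (subst nodes_conv_subtrees) auto
  also have "card \<dots> = (\<Sum>i\<in>{1..out_degree [] t}. card ((#) i ` {u \<in> nodes (subtree [i] t). length u = b}))"
    by (rule card_UN_disjoint) (use finite_level in auto)
  also have "\<dots> = (\<Sum>i\<in>{1..out_degree [] t}. level_size b (subtree [i] t))"
    unfolding level_size_def by (intro sum.cong refl card_image) simp
  finally show ?thesis by (simp add: level_size_def)
qed

lemma level_size_le_width: "enat (level_size b t) \<le> width t"
  unfolding width_def by (rule SUP_upper) simp

lemma width_subtree_le:
  assumes i: "i \<in> {1..out_degree [] t}"
  shows "width (subtree [i] t) \<le> width t"
  unfolding width_def[of "subtree [i] t"]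
proof (rule SUP_least)
  fix b
  have "level_size b (subtree [i] t) \<le> level_size (Suc b) t"
    unfolding level_size_Suc using i by (intro member_le_sum) auto
  then show "enat (level_size b (subtree [i] t)) \<le> width t"
    using level_size_le_width[of "Suc b" t] by (meson enat_ord_simps(1) order_trans)
qed

text \<open>
  Level \<open>b + 1\<close> is the union of the levels \<open>b\<close> of the finitely many subtrees at the children of the
  root, so finite bounds on the widths of these subtrees add up to a bound for the whole tree.
\<close>
lemma width_finite_iff:
  "width t < \<infinity> \<longleftrightarrow> (\<forall>i\<in>{1..out_degree [] t}. width (subtree [i] t) < \<infinity>)"
proof
  assume "width t < \<infinity>"
  then show "\<forall>i\<in>{1..out_degree [] t}. width (subtree [i] t) < \<infinity>"
    using width_subtree_le order_le_less_trans by blast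
next
  assume "\<forall>i\<in>{1..out_degree [] t}. width (subtree [i] t) < \<infinity>"
  then have "\<forall>i\<in>{1..out_degree [] t}. \<exists>n. width (subtree [i] t) = enat n"
    by auto
  then obtain N where N: "\<And>i. i \<in> {1..out_degree [] t} \<Longrightarrow> width (subtree [i] t) = enat (N i)"
    by metis
  have "level_size b t \<le> 1 + (\<Sum>i\<in>{1..out_degree [] t}. N i)" for b
  proof (cases b)
    case (Suc c)
    have "level_size c (subtree [i] t) \<le> N i" if "i \<in> {1..out_degree [] t}" for i
      using level_size_le_width[of c "subtree [i] t"] N[OF that] by simp
    then have "level_size b t \<le> (\<Sum>i\<in>{1..out_degree [] t}. N i)"
      unfolding Suc level_size_Suc by (rule sum_mono)
    then show ?thesis by simp
  qed simp
  then have "width t \<le> enat (1 + (\<Sum>i\<in>{1..out_degree [] t}. N i))"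
    unfolding width_def by (intro SUP_least) simp
  then show "width t < \<infinity>"
    by (meson enat_ord_code(4) order_le_less_trans)
qed

section \<open>Truncation and the topology of trees\<close>

lemma truncate_eq_iff:
  "truncate h s = truncate h t \<longleftrightarrow> (\<forall>u. length u \<le> h \<longrightarrow> (u \<in> nodes s \<longleftrightarrow> u \<in> nodes t))"
  by (auto simp: nodes_inject[symmetric] truncate.rep_eq set_eq_iff)

lemma out_degree_truncate_cong:
  "truncate h s = truncate h t \<Longrightarrow> length u < h \<Longrightarrow> out_degree u s = out_degree u t"
  unfolding out_degree_def truncate_eq_iff by simp

lemma level_size_truncate_cong:
  "truncate h s = truncate h t \<Longrightarrow> b \<le> h \<Longrightarrow> level_size b s = level_size b t"
  unfolding level_size_def truncate_eq_iff by (intro arg_cong[where f = card]) auto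

lemma truncate_Suc_eq_iff:
  "truncate (Suc h) s = truncate (Suc h) t \<longleftrightarrow>
     out_degree [] s = out_degree [] t \<and>
     (\<forall>i\<in>{1..out_degree [] t}. truncate h (subtree [i] s) = truncate h (subtree [i] t))"
    (is "?L \<longleftrightarrow> ?R")
proof
  assume L: ?L
  have d: "out_degree [] s = out_degree [] t"
    by (rule out_degree_truncate_cong[OF L]) simp
  have "truncate h (subtree [i] s) = truncate h (subtree [i] t)" if "i \<in> {1..out_degree [] t}" for i
    using L that nodes_subtree[of i s] nodes_subtree[of i t] d by (simp add: truncate_eq_iff)
  with d show ?R by blast
next
  assume R: ?R
  show ?L
    unfolding truncate_eq_iff
  proof (intro allI impI)
    fix u :: "nat list" assume u: "length u \<le> Suc h"
    show "u \<in> nodes s \<longleftrightarrow> u \<in> nodes t"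
    proof (cases u)
      case (Cons i v)
      show ?thesis
      proof (cases "i \<in> {1..out_degree [] t}")
        case True
        then have "v \<in> nodes (subtree [i] s) \<longleftrightarrow> v \<in> nodes (subtree [i] t)"
          using R u Cons by (simp add: truncate_eq_iff)
        then show ?thesis
          using True R Cons nodes_subtree[of i s] nodes_subtree[of i t] by simp
      next
        case False
        then show ?thesis
          using R Cons Cons_in_nodesD[of i v s] Cons_in_nodesD[of i v t] by auto
      qed
    qed simp
  qed
qed

text \<open>
  The trees that agree with \<open>t\<close> up to height \<open>h\<close>. The centre \<open>t\<close> is an arbitrary tree, not
  necessarily of height at most \<open>h\<close>; only its truncation matters.
\<close>
definition cell :: "nat \<Rightarrow> tree \<Rightarrow> tree set" where
  "cell h t = {s. truncate h s = truncate h t}"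

lemma mem_cell_self [simp]: "t \<in> cell h t"
  by (simp add: cell_def)

lemma cell_antimono: "h \<le> k \<Longrightarrow> cell k t \<subseteq> cell h t"
  unfolding cell_def using truncate_eq_mono by blast

lemma dist_le_if_truncate_eq:
  assumes "truncate h s = truncate h t"
  shows "dist s t \<le> 1 / 2 ^ h"
proof (cases "s = t")
  case False
  let ?S = "{h. truncate h s = truncate h t}"
  have "h \<le> Sup ?S"
    unfolding Sup_nat_def using finite_truncate_eq[OF False] assms by auto
  then show ?thesis
    using False by (simp add: dist_tree_def field_simps)
qed simp

lemma truncate_eq_if_dist_less:
  assumes "dist s t < 1 / 2 ^ h"
  shows "truncate h s = truncate h t"
proof (rule ccontr)
  assume neq: "truncate h s \<noteq> truncate h t"
  then have "s \<noteq> t" by auto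
  let ?S = "{h. truncate h s = truncate h t}"
  have "Sup ?S \<in> ?S"
    using Max_in[OF finite_truncate_eq[OF \<open>s \<noteq> t\<close>]] truncate_0[of s t]
    by (auto simp: Sup_nat_def)
  then have "Sup ?S < h"
    using neq truncate_eq_mono[of "Sup ?S" s t h] by (meson mem_Collect_eq not_le)
  then have "(1::real) / 2 ^ h \<le> 1 / 2 ^ Sup ?S"
    by (simp add: field_simps)
  with assms \<open>s \<noteq> t\<close> show False
    by (simp add: dist_tree_def)
qed

text \<open>
  A cell contains a ball about each of its points and every ball about \<open>t\<close> contains a cell of
  \<open>t\<close>; so cells form a base of the topology. As there are countably many of them, they also
  generate the Borel sets.
\<close>
lemma open_tree_iff:
  fixes U :: "tree set"
  shows "open U \<longleftrightarrow> (\<forall>t\<in>U. \<exists>h. cell h t \<subseteq> U)"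
proof
  assume U: "open U"
  show "\<forall>t\<in>U. \<exists>h. cell h t \<subseteq> U"
  proof
    fix t assume "t \<in> U"
    then obtain e where e: "e > 0" "\<And>s. dist s t < e \<Longrightarrow> s \<in> U"
      using U unfolding open_dist by blast
    obtain h where h: "(1 / 2) ^ h < e"
      using real_arch_pow_inv[OF e(1), of "1/2"] by auto
    have "cell h t \<subseteq> U"
    proof
      fix s assume "s \<in> cell h t"
      then have "dist s t \<le> 1 / 2 ^ h"
        by (intro dist_le_if_truncate_eq) (simp add: cell_def)
      with h show "s \<in> U"
        by (intro e(2)) (simp add: power_one_over)
    qed
    then show "\<exists>h. cell h t \<subseteq> U" ..
  qed
next
  assume U: "\<forall>t\<in>U. \<exists>h. cell h t \<subseteq> U"
  show "open U"
    unfolding open_dist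
  proof
    fix t assume "t \<in> U"
    then obtain h where h: "cell h t \<subseteq> U" using U by blast
    show "\<exists>e>0. \<forall>s. dist s t < e \<longrightarrow> s \<in> U"
    proof (intro exI[of _ "1 / 2 ^ h"] conjI allI impI)
      fix s assume "dist s t < 1 / 2 ^ h"
      then have "s \<in> cell h t"
        unfolding cell_def by (simp only: mem_Collect_eq truncate_eq_if_dist_less)
      with h show "s \<in> U" by blast
    qed simp
  qed
qed

text \<open>A property that depends only on a truncation at a fixed height defines an open set.\<close>
lemma open_tree_local:
  assumes "\<And>s t. truncate h s = truncate h t \<Longrightarrow> P t \<Longrightarrow> P s"
  shows "open {t. P t}"
  unfolding open_tree_iff using assms by (auto simp: cell_def)

lemma open_cell: "open (cell h t)"
  unfolding cell_def by (rule open_tree_local[of h]) simp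

lemma cell_in_borel [measurable]: "cell h t \<in> sets borel"
  using open_cell by simp

lemma countable_range_truncate: "countable (range (truncate h))"
proof -
  have "nodes ` range (truncate h) \<subseteq> {A. finite A}"
    using finite_nodes_le by (auto simp: truncate.rep_eq)
  then have "countable (nodes ` range (truncate h))"
    using countable_Collect_finite countable_subset by blast
  then show ?thesis
    by (rule countable_image_inj_on) (simp add: inj_on_def nodes_inject)
qed

lemma cell_truncate: "k \<ge> h \<Longrightarrow> cell h (truncate k t) = cell h t"
  by (simp add: cell_def truncate_truncate min_def)

lemma countable_cells: "countable {cell h t | h t. True}"
proof -
  have "{cell h t | h t. True} \<subseteq> (\<Union>h. cell h ` range (truncate h))"
    using cell_truncate by blast
  then show ?thesis
    by (rule countable_subset) (simp add: countable_range_truncate)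
qed

lemma measurable_treeI:
  assumes "\<And>h t. f -` cell h t \<inter> space M \<in> sets M"
  shows "f \<in> borel_measurable M"
proof (rule borel_measurableI)
  fix U :: "tree set" assume "open U"
  define C where "C = {B \<in> {cell h t | h t. True}. B \<subseteq> U}"
  have "countable C"
    unfolding C_def by (rule countable_subset[OF _ countable_cells]) auto
  have "U = \<Union>C"
  proof
    show "U \<subseteq> \<Union>C"
    proof
      fix t assume "t \<in> U"
      then obtain h where "cell h t \<subseteq> U"
        using \<open>open U\<close> unfolding open_tree_iff by blast
      then have "cell h t \<in> C" by (auto simp: C_def)
      then show "t \<in> \<Union>C" using mem_cell_self by blast
    qed
  qed (auto simp: C_def)
  then have "f -` U \<inter> space M = (\<Union>B\<in>C. f -` B \<inter> space M)" by blast
  also have "\<dots> \<in> sets M"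
    using \<open>countable C\<close> assms by (intro sets.countable_UN') (auto simp: C_def)
  finally show "f -` U \<inter> space M \<in> sets M" .
qed

lemma out_degree_root_in_borel [measurable]: "{t. out_degree [] t = n} \<in> sets borel"
proof -
  have "open {t. out_degree [] t = n}"
    by (rule open_tree_local[of 1]) (metis out_degree_truncate_cong list.size(3) zero_less_one)
  then show ?thesis by simp
qed

lemma level_size_in_borel: "{t. P (level_size b t)} \<in> sets borel"
proof -
  have "open {t. P (level_size b t)}"
    by (rule open_tree_local[of b]) (metis level_size_truncate_cong order_refl)
  then show ?thesis by simp
qed

lemma width_le_iff: "width t \<le> enat n \<longleftrightarrow> (\<forall>b. level_size b t \<le> n)"
  by (auto simp: width_def SUP_le_iff)

lemma width_le_in_borel [measurable]: "{t. width t \<le> enat n} \<in> sets borel"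
proof -
  have "{t. width t \<le> enat n} = (\<Inter>b. {t. level_size b t \<le> n})"
    by (auto simp: width_le_iff)
  also have "\<dots> \<in> sets borel"
    using level_size_in_borel[of "\<lambda>x. x \<le> n"] by (intro sets.countable_INT') auto
  finally show ?thesis .
qed

lemma width_gr_in_borel [measurable]: "{t. width t > enat n} \<in> sets borel"
proof -
  have "{t. width t > enat n} = - {t. width t \<le> enat n}" by auto
  then show ?thesis by simp
qed

lemma width_finite_in_borel [measurable]: "{t. width t < \<infinity>} \<in> sets borel"
proof -
  have "{t. width t < \<infinity>} = (\<Union>n. {t. width t \<le> enat n})"
  proof (intro set_eqI)
    fix t show "t \<in> {t. width t < \<infinity>} \<longleftrightarrow> t \<in> (\<Union>n. {t. width t \<le> enat n})"
      by (cases "width t") (auto intro: exI[of _ "the_enat (width t)"])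
  qed
  then show ?thesis by simp
qed

lemma subtree_measurable [measurable]: "subtree [i] \<in> borel_measurable borel"
proof (rule measurable_treeI)
  fix h t
  have "open {s. subtree [i] s \<in> cell h t}"
  proof (rule open_tree_local[of "Suc h"])
    fix s s' assume eq: "truncate (Suc h) s = truncate (Suc h) s'"
      and s': "subtree [i] s' \<in> cell h t"
    have iff: "[i] \<in> nodes s \<longleftrightarrow> [i] \<in> nodes s'"
      using eq unfolding truncate_eq_iff by simp
    have "truncate h (subtree [i] s) = truncate h (subtree [i] s')"
      using eq iff unfolding truncate_eq_iff by (simp add: subtree.rep_eq)
    with s' show "subtree [i] s \<in> cell h t" by (simp add: cell_def)
  qed
  then show "subtree [i] -` cell h t \<inter> space borel \<in> sets borel"
    by (simp add: vimage_def)
qed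

lemma cell_Suc:
  "cell (Suc h) t = {s. out_degree [] s = out_degree [] t \<and>
     (\<forall>i\<in>{1..out_degree [] t}. subtree [i] s \<in> cell h (subtree [i] t))}"
  by (auto simp: cell_def truncate_Suc_eq_iff)

section \<open>Convergence in law through cells\<close>

text \<open>The integral of a function of the truncation at height \<open>h\<close> is a sum over the countably many
  values of the truncation.\<close>
lemma nn_integral_cellwise:
  assumes "prob_space Q" "sets Q = sets (borel :: tree measure)"
    and g: "\<And>t. g t = G (truncate h t)"
  shows "(\<integral>\<^sup>+t. g t \<partial>Q) =
    (\<integral>\<^sup>+s. G s * emeasure Q (cell h s) \<partial>count_space (range (truncate h)))"
proof -
  let ?R = "range (truncate h)"
  have sp: "space Q = UNIV"
    using sets_eq_imp_space_eq[OF assms(2)] by simp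
  have vim: "truncate h -` {s} = cell h s" if "s \<in> ?R" for s
    using that by (auto simp: cell_def truncate_truncate)
  have meas: "truncate h \<in> measurable Q (count_space ?R)"
    unfolding measurable_count_space_eq_countable[OF countable_range_truncate]
    using vim cell_in_borel by (auto simp: sp assms(2))
  have "distr Q (count_space ?R) (truncate h) = density (count_space ?R) (\<lambda>s. emeasure Q (cell h s))"
  proof (rule measure_eqI_countable[where A = ?R])
    fix s assume "s \<in> ?R"
    then show "emeasure (distr Q (count_space ?R) (truncate h)) {s} =
        emeasure (density (count_space ?R) (\<lambda>s. emeasure Q (cell h s))) {s}"
      using meas vim[of s] by (simp add: emeasure_distr sp emeasure_density nn_integral_cmult_indicator)
  qed (simp_all add: countable_range_truncate)
  then have "(\<integral>\<^sup>+s. G s \<partial>distr Q (count_space ?R) (truncate h)) =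
      (\<integral>\<^sup>+s. G s * emeasure Q (cell h s) \<partial>count_space ?R)"
    by (simp add: nn_integral_density mult.commute)
  then show ?thesis
    using meas by (simp add: nn_integral_distr g)
qed

text \<open>
  Replacing \<open>f\<close> by its infimum over the cell at height \<open>h\<close> gives functions that depend only on the
  truncation and increase to \<open>f\<close> as \<open>h\<close> grows, by continuity. For each of them the claim is Fatou's
  lemma for the sum over the cells.
\<close>
lemma nn_integral_le_liminf_if_cells:
  fixes Q :: "nat \<Rightarrow> tree measure" and f :: "tree \<Rightarrow> ennreal"
  assumes Q: "\<And>n. prob_space (Q n)" "\<And>n. sets (Q n) = sets borel"
    and Q': "prob_space Q'" "sets Q' = sets borel"
    and cells: "\<And>h t. emeasure Q' (cell h t) \<le> liminf (\<lambda>n. emeasure (Q n) (cell h t))"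
    and f: "continuous_on UNIV f"
  shows "(\<integral>\<^sup>+t. f t \<partial>Q') \<le> liminf (\<lambda>n. \<integral>\<^sup>+t. f t \<partial>Q n)"
proof -
  define g where "g h t = (INF s\<in>cell h t. f s)" for h t
  have g_le: "g h t \<le> f t" for h t
    unfolding g_def by (rule INF_lower) simp
  have g_trunc: "g h t = g h (truncate h t)" for h t
    unfolding g_def by (simp add: cell_truncate)
  have fM: "f \<in> borel_measurable Q'"
    using borel_measurable_continuous_onI[OF f] by (simp cong: measurable_cong_sets add: Q'(2))
  have gM: "g h \<in> borel_measurable Q'" for h
  proof -
    have "g h -` A \<in> sets Q'" for A
    proof -
      have "open {t. g h t \<in> A}"
        by (rule open_tree_local[of h]) (metis g_trunc)
      then show ?thesis by (simp add: Q'(2) vimage_def)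
    qed
    then show ?thesis
      using sets_eq_imp_space_eq[OF Q'(2)] by (intro measurableI) auto
  qed
  have SUP_g: "(SUP h. g h t) = f t" for t
  proof (rule antisym)
    show "(SUP h. g h t) \<le> f t" by (rule SUP_least) (rule g_le)
    show "f t \<le> (SUP h. g h t)"
    proof (rule dense_le)
      fix y assume "y < f t"
      have "open {s. y < f s}"
        by (rule open_Collect_less) (use f in \<open>auto intro: continuous_intros\<close>)
      then obtain h where "cell h t \<subseteq> {s. y < f s}"
        using \<open>y < f t\<close> unfolding open_tree_iff by blast
      then have "y \<le> g h t"
        unfolding g_def by (intro INF_greatest) (auto intro: less_imp_le)
      then show "y \<le> (SUP h. g h t)" by (rule SUP_upper2[rotated]) simp
    qed
  qed
  have "incseq g"
    unfolding g_def incseq_def le_fun_def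
    by (intro allI impI INF_superset_mono cell_antimono order_refl)
  have "(\<integral>\<^sup>+t. g h t \<partial>Q') \<le> liminf (\<lambda>n. \<integral>\<^sup>+t. f t \<partial>Q n)" for h
  proof -
    let ?C = "count_space (range (truncate h))"
    have "(\<integral>\<^sup>+t. g h t \<partial>Q') = (\<integral>\<^sup>+s. g h s * emeasure Q' (cell h s) \<partial>?C)"
      by (rule nn_integral_cellwise[OF Q']) (rule g_trunc)
    also have "\<dots> \<le> (\<integral>\<^sup>+s. liminf (\<lambda>n. g h s * emeasure (Q n) (cell h s)) \<partial>?C)"
    proof (rule nn_integral_mono)
      fix s
      have "g h s * emeasure Q' (cell h s) \<le> g h s * liminf (\<lambda>n. emeasure (Q n) (cell h s))"
        by (rule mult_left_mono[OF cells]) simp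
      also have "\<dots> \<le> liminf (\<lambda>n. g h s * emeasure (Q n) (cell h s))"
        unfolding liminf_SUP_INF SUP_mult_left_ennreal
        by (intro SUP_mono' INF_greatest mult_left_mono INF_lower) simp_all
      finally show "g h s * emeasure Q' (cell h s) \<le> liminf (\<lambda>n. g h s * emeasure (Q n) (cell h s))" .
    qed
    also have "\<dots> \<le> liminf (\<lambda>n. \<integral>\<^sup>+s. g h s * emeasure (Q n) (cell h s) \<partial>?C)"
      by (rule nn_integral_liminf) simp
    also have "\<dots> = liminf (\<lambda>n. \<integral>\<^sup>+t. g h t \<partial>Q n)"
      by (simp add: nn_integral_cellwise[OF Q, of "g h" "g h" h] g_trunc[symmetric])
    also have "\<dots> \<le> liminf (\<lambda>n. \<integral>\<^sup>+t. f t \<partial>Q n)"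
      by (intro Liminf_mono always_eventually allI nn_integral_mono g_le)
    finally show ?thesis .
  qed
  then have "(SUP h. \<integral>\<^sup>+t. g h t \<partial>Q') \<le> liminf (\<lambda>n. \<integral>\<^sup>+t. f t \<partial>Q n)"
    by (rule SUP_least)
  moreover have "(\<integral>\<^sup>+t. f t \<partial>Q') = (SUP h. \<integral>\<^sup>+t. g h t \<partial>Q')"
    unfolding SUP_g[symmetric] by (rule nn_integral_monotone_convergence_SUP[OF \<open>incseq g\<close> gM])
  ultimately show ?thesis by simp
qed

text \<open>
  For bounded real \<open>f\<close>, adding a bound \<open>B\<close> of \<open>\<bar>f\<bar>\<close> makes the integrand nonnegative and shifts all
  the integrals by the same constant, because the measures have mass \<open>1\<close>.
\<close>
lemma eventually_integral_gr_if_cells: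
  fixes Q :: "nat \<Rightarrow> tree measure" and f :: "tree \<Rightarrow> real"
  assumes Q: "\<And>n. prob_space (Q n)" "\<And>n. sets (Q n) = sets borel"
    and Q': "prob_space Q'" "sets Q' = sets borel"
    and cells: "\<And>h t. emeasure Q' (cell h t) \<le> liminf (\<lambda>n. emeasure (Q n) (cell h t))"
    and f: "continuous_on UNIV f" "bounded (range f)"
    and a: "a < integral\<^sup>L Q' f"
  shows "\<forall>\<^sub>F n in sequentially. a < integral\<^sup>L (Q n) f"
proof -
  obtain B where B: "B > 0" "\<And>t. \<bar>f t\<bar> \<le> B"
    using f(2) unfolding bounded_pos by auto
  have int: "integrable R f" "ennreal (integral\<^sup>L R f + B) = (\<integral>\<^sup>+t. ennreal (f t + B) \<partial>R)"
    if R: "prob_space R" "sets R = sets (borel :: tree measure)" for R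
  proof -
    interpret R: prob_space R by (rule R)
    have "f \<in> borel_measurable R"
      using borel_measurable_continuous_onI[OF f(1)] by (simp cong: measurable_cong_sets add: R(2))
    then show int: "integrable R f"
      by (rule R.integrable_const_bound[rotated]) (use B(2) in auto)
    have "0 \<le> f t + B" for t
      using B(2)[of t] by simp
    then have "(\<integral>\<^sup>+t. ennreal (f t + B) \<partial>R) = ennreal (\<integral>t. f t + B \<partial>R)"
      by (intro nn_integral_eq_integral) (use int in auto)
    also have "(\<integral>t. f t + B \<partial>R) = integral\<^sup>L R f + B"
      using int R.prob_space by simp
    finally show "ennreal (integral\<^sup>L R f + B) = (\<integral>\<^sup>+t. ennreal (f t + B) \<partial>R)" ..
  qed
  have "- B \<le> integral\<^sup>L Q' f"
  proof -
    interpret Q': prob_space Q' by (rule Q'(1))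
    show ?thesis
      by (rule Q'.integral_ge_const[OF int(1)[OF Q']]) (use B(2) in \<open>auto simp: abs_le_iff minus_le_iff\<close>)
  qed
  show ?thesis
  proof (cases "integral\<^sup>L Q' f + B > 0")
    case True
    have "continuous_on UNIV (\<lambda>t. ennreal (f t + B))"
      by (intro continuous_on_ennreal continuous_intros f)
    then have "ennreal (integral\<^sup>L Q' f + B) \<le> liminf (\<lambda>n. ennreal (integral\<^sup>L (Q n) f + B))"
      using nn_integral_le_liminf_if_cells[OF Q Q' cells, of "\<lambda>t. ennreal (f t + B)"]
      by (simp add: int(2)[OF Q] int(2)[OF Q'])
    moreover have "ennreal (a + B) < ennreal (integral\<^sup>L Q' f + B)"
      using True a by (intro ennreal_lessI) auto
    ultimately have "\<forall>\<^sub>F n in sequentially. ennreal (a + B) < ennreal (integral\<^sup>L (Q n) f + B)"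
      unfolding le_Liminf_iff by blast
    then show ?thesis
    proof eventually_elim
      case (elim n)
      then have "a + B < integral\<^sup>L (Q n) f + B"
        using ennreal_leI not_le by metis
      then show ?case by simp
    qed
  next
    case False
    have "a < integral\<^sup>L (Q n) f" for n
    proof -
      interpret Q: prob_space "Q n" by (rule Q(1))
      have "- B \<le> integral\<^sup>L (Q n) f"
        by (rule Q.integral_ge_const[OF int(1)[OF Q]]) (use B(2) in \<open>auto simp: abs_le_iff minus_le_iff\<close>)
      then show ?thesis using False a by simp
    qed
    then show ?thesis by simp
  qed
qed

text \<open>
  One-sided bounds on cells suffice: they bound the integrals of \<open>f\<close> from below in the limit, and
  the same for \<open>- f\<close> bounds them from above.
\<close>
lemma converges_in_law_if_cells:
  fixes Q :: "nat \<Rightarrow> tree measure"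
  assumes Q: "\<And>n. prob_space (Q n)" "\<And>n. sets (Q n) = sets borel"
    and Q': "prob_space Q'" "sets Q' = sets borel"
    and cells: "\<And>h t. emeasure Q' (cell h t) \<le> liminf (\<lambda>n. emeasure (Q n) (cell h t))"
  shows "converges_in_law Q Q'"
  unfolding converges_in_law_def
proof (intro allI impI order_tendstoI)
  fix f :: "tree \<Rightarrow> real" and a
  assume f: "continuous_on UNIV f" "bounded (range f)"
  {
    assume "a < integral\<^sup>L Q' f"
    then show "\<forall>\<^sub>F n in sequentially. a < integral\<^sup>L (Q n) f"
      by (rule eventually_integral_gr_if_cells[OF Q Q' cells f])
  next
    assume a: "integral\<^sup>L Q' f < a"
    have "continuous_on UNIV (\<lambda>t. - f t)"
      by (intro continuous_intros f)
    moreover have "bounded (range (\<lambda>t. - f t))"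
      using f(2) unfolding bounded_iff by auto
    ultimately have "\<forall>\<^sub>F n in sequentially. - a < (\<integral>t. - f t \<partial>Q n)"
      using a by (intro eventually_integral_gr_if_cells[OF Q Q' cells]) auto
    then show "\<forall>\<^sub>F n in sequentially. integral\<^sup>L (Q n) f < a" by simp
  }
qed

section \<open>Offspring distributions and weights\<close>

lemma sums_pmf_nat:
  fixes f :: "nat \<Rightarrow> real"
  assumes "integrable (measure_pmf p) f"
  shows "(\<lambda>n. pmf p n * f n) sums measure_pmf.expectation p f"
proof -
  have "integrable (count_space UNIV) (\<lambda>n. pmf p n * f n)"
    using assms by (simp add: measure_pmf_eq_density integrable_density)
  then show ?thesis
    using sums_integral_count_space_nat[of "\<lambda>n. pmf p n * f n"]
    by (simp add: measure_pmf_eq_density integral_density)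
qed

lemma critical_sums:
  "critical p \<Longrightarrow> (\<lambda>n. pmf p n * real n) sums 1"
  using sums_pmf_nat[of p real] by (simp add: critical_def offspring_mean_def)

text \<open>A distribution on \<open>{0, 1}\<close> with mean \<open>1\<close> is concentrated on \<open>1\<close>, which \<open>pmf p 1 \<noteq> 1\<close> excludes.\<close>
lemma critical_imp_ge2:
  assumes "critical p"
  obtains k where "k \<in> set_pmf p" "k \<ge> 2"
proof -
  have "\<exists>k\<in>set_pmf p. k \<ge> 2"
  proof (rule ccontr)
    assume *: "\<not> (\<exists>k\<in>set_pmf p. k \<ge> 2)"
    have "(\<lambda>n. pmf p n * real n) sums (\<Sum>n\<in>{1}. pmf p n * real n)"
    proof (rule sums_finite)
      fix n :: nat assume "n \<notin> {1}"
      then have "n = 0 \<or> n \<ge> 2" by auto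
      then show "pmf p n * real n = 0"
        using * by (auto simp: set_pmf_iff)
    qed simp
    then have "pmf p 1 = 1"
      using sums_unique2[OF critical_sums[OF assms]] by simp
    then show False
      using assms by (simp add: critical_def)
  qed
  then show thesis using that by blast
qed

text \<open>
  The probability that a Galton-Watson tree with offspring distribution \<open>p\<close> agrees with \<open>t\<close> up to
  height \<open>h\<close>: the nodes below height \<open>h\<close> have to have the right number of children.
\<close>
definition weight :: "nat pmf \<Rightarrow> nat \<Rightarrow> tree \<Rightarrow> real" where
  "weight p h t = (\<Prod>u\<in>{u \<in> nodes t. length u < h}. pmf p (out_degree u t))"

lemma weight_nonneg: "weight p h t \<ge> 0"
  unfolding weight_def by (intro prod_nonneg) simp

lemma weight_0 [simp]: "weight p 0 t = 1"
  by (simp add: weight_def)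

lemma weight_Suc:
  "weight p (Suc h) t =
     pmf p (out_degree [] t) * (\<Prod>i\<in>{1..out_degree [] t}. weight p h (subtree [i] t))"
proof -
  let ?I = "{1..out_degree [] t}"
  let ?S = "\<lambda>i. {u \<in> nodes (subtree [i] t). length u < h}"
  have "{u \<in> nodes t. length u < Suc h} = insert [] (\<Union>i\<in>?I. (#) i ` ?S i)"
    by (subst nodes_conv_subtrees) auto
  then have "weight p (Suc h) t = (\<Prod>u\<in>insert [] (\<Union>i\<in>?I. (#) i ` ?S i). pmf p (out_degree u t))"
    by (simp add: weight_def)
  also have "\<dots> = pmf p (out_degree [] t) * (\<Prod>u\<in>(\<Union>i\<in>?I. (#) i ` ?S i). pmf p (out_degree u t))"
    by (rule prod.insert) (auto simp: finite_nodes_less)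
  also have "(\<Prod>u\<in>(\<Union>i\<in>?I. (#) i ` ?S i). pmf p (out_degree u t)) =
      (\<Prod>i\<in>?I. \<Prod>u\<in>(#) i ` ?S i. pmf p (out_degree u t))"
    by (rule prod.UNION_disjoint) (auto simp: finite_nodes_less)
  also have "\<dots> = (\<Prod>i\<in>?I. weight p h (subtree [i] t))"
    unfolding weight_def
  proof (rule prod.cong[OF refl])
    fix i assume i: "i \<in> ?I"
    show "(\<Prod>u\<in>(#) i ` ?S i. pmf p (out_degree u t)) =
        (\<Prod>u\<in>?S i. pmf p (out_degree u (subtree [i] t)))"
      by (subst prod.reindex) (simp_all add: out_degree_subtree[OF i])
  qed
  finally show ?thesis .
qed

text \<open>The equality case of Bernoulli's inequality, read off from
  \<open>1 - r\<^sup>k = (1 - r) (1 + r + \<dots> + r\<^sup>k\<^sup>-\<^sup>1)\<close>.\<close>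
lemma Bernoulli_equality_imp_eq_1:
  fixes r :: real
  assumes r: "0 \<le> r" "r \<le> 1" and k: "k \<ge> 2" and eq: "r ^ k = 1 - real k * (1 - r)"
  shows "r = 1"
proof (rule ccontr)
  assume "r \<noteq> 1"
  then have "r < 1" using r by simp
  have "(\<Sum>j<k. r ^ j) < (\<Sum>j<k. 1)"
  proof (rule sum_strict_mono_ex1)
    show "\<exists>j\<in>{..<k}. r ^ j < 1"
      using k \<open>r < 1\<close> by (intro bexI[of _ 1]) auto
  qed (use r in \<open>auto intro: power_le_one\<close>)
  then have "(1 - r) * (\<Sum>j<k. r ^ j) < (1 - r) * real k"
    using \<open>r < 1\<close> by simp
  moreover have "1 - r ^ k = (1 - r) * (\<Sum>j<k. r ^ j)"
    by (rule one_diff_power_eq)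
  ultimately show False
    using eq by (simp add: mult.commute)
qed

lemma tendsto_geometric_quotient:
  fixes v :: "nat \<Rightarrow> real"
  assumes v: "v \<longlonglongrightarrow> 0" "\<And>n. v n > 0"
  shows "(\<lambda>n. (1 - (1 - v n) ^ k) / v n) \<longlonglongrightarrow> real k"
proof -
  have "(\<lambda>n. \<Sum>j<k. (1 - v n) ^ j) \<longlonglongrightarrow> (\<Sum>j<k. (1 - 0) ^ j)"
    by (intro tendsto_intros v)
  moreover have "(1 - (1 - v n) ^ k) / v n = (\<Sum>j<k. (1 - v n) ^ j)" for n
    using one_diff_power_eq[of "1 - v n" k] v(2)[of n] by (simp add: field_simps)
  ultimately show ?thesis by simp
qed

section \<open>Galton-Watson laws\<close>

text \<open>
  The law of a Galton-Watson tree, described by a single product formula: the root has \<open>n\<close> children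
  with probability \<open>pmf p n\<close>, and then the subtrees at the children are independent with law \<open>L\<close>.
\<close>
locale branching_law = prob_space L for L :: "tree measure" +
  fixes p :: "nat pmf"
  assumes sets_L: "sets L = sets borel"
    and branching: "\<And>n E. (\<And>i. E i \<in> sets borel) \<Longrightarrow>
      measure L {t. out_degree [] t = n \<and> (\<forall>i\<in>{1..n}. subtree [i] t \<in> E i)} =
        pmf p n * (\<Prod>i\<in>{1..n}. measure L (E i))"

lemma root_branching_in_borel:
  assumes "\<And>i. E i \<in> sets borel"
  shows "{t. out_degree [] t = n \<and> (\<forall>i\<in>{1..n}. subtree [i] t \<in> E i)} \<in> sets borel"
proof -
  have "subtree [i] -` E i \<in> sets borel" for i
    using measurable_sets[OF subtree_measurable[of i] assms[of i]] by simp
  then have "{t. out_degree [] t = n} \<inter> (\<Inter>i\<in>{1..n}. subtree [i] -` E i) \<in> sets borel"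
    by (cases "n = 0") (auto intro!: sets.Int sets.finite_INT out_degree_root_in_borel)
  also have "{t. out_degree [] t = n} \<inter> (\<Inter>i\<in>{1..n}. subtree [i] -` E i) =
      {t. out_degree [] t = n \<and> (\<forall>i\<in>{1..n}. subtree [i] t \<in> E i)}"
    by auto
  finally show ?thesis .
qed

lemma branching_law_galton_watson:
  assumes "galton_watson_tree p M \<tau>"
  shows "branching_law (distr M borel \<tau>) p"
proof -
  interpret M: prob_space M
    using assms by (simp add: galton_watson_tree_def)
  have \<tau> [measurable]: "\<tau> \<in> borel_measurable M"
    and deg: "distr M (count_space UNIV) (\<lambda>\<omega>. out_degree [] (\<tau> \<omega>)) = measure_pmf p"
    using assms by (simp_all add: galton_watson_tree_def)
  interpret L: prob_space "distr M borel \<tau>"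
    by (rule M.prob_space_distr) simp
  show ?thesis
  proof
    fix n and E :: "nat \<Rightarrow> tree set"
    assume E: "\<And>i. E i \<in> sets borel"
    define D where "D = {\<omega> \<in> space M. out_degree [] (\<tau> \<omega>) = n}"
    have D_vimage: "D = \<tau> -` {t. out_degree [] t = n} \<inter> space M"
      by (auto simp: D_def)
    have D: "D \<in> sets M"
      unfolding D_vimage by (rule measurable_sets[OF \<tau> out_degree_root_in_borel])
    have degM: "(\<lambda>\<omega>. out_degree [] (\<tau> \<omega>)) \<in> measurable M (count_space UNIV)"
    proof (rule measurable_count_space_eq_countable[THEN iffD2]; safe?)
      fix k
      have "(\<lambda>\<omega>. out_degree [] (\<tau> \<omega>)) -` {k} \<inter> space M = \<tau> -` {t. out_degree [] t = k} \<inter> space M"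
        by auto
      then show "(\<lambda>\<omega>. out_degree [] (\<tau> \<omega>)) -` {k} \<inter> space M \<in> sets M"
        using measurable_sets[OF \<tau> out_degree_root_in_borel[of k]] by simp
    qed auto
    have prob_D: "M.prob D = pmf p n"
    proof -
      have "pmf p n = measure (distr M (count_space UNIV) (\<lambda>\<omega>. out_degree [] (\<tau> \<omega>))) {n}"
        by (simp add: deg measure_pmf_single)
      also have "\<dots> = M.prob ((\<lambda>\<omega>. out_degree [] (\<tau> \<omega>)) -` {n} \<inter> space M)"
        by (rule measure_distr[OF degM]) simp
      also have "(\<lambda>\<omega>. out_degree [] (\<tau> \<omega>)) -` {n} \<inter> space M = D"
        by (auto simp: D_def)
      finally show ?thesis ..
    qed
    define F where "F = {\<omega> \<in> space M. \<forall>i\<in>{1..n}. subtree [i] (\<tau> \<omega>) \<in> E i}"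
    have "measure (distr M borel \<tau>) {t. out_degree [] t = n \<and> (\<forall>i\<in>{1..n}. subtree [i] t \<in> E i)} =
        M.prob (D \<inter> F)"
      by (subst measure_distr[OF \<tau> root_branching_in_borel[OF E]])
        (auto simp: D_def F_def intro!: arg_cong[where f = M.prob])
    also have "\<dots> = pmf p n * (\<Prod>i\<in>{1..n}. measure (distr M borel \<tau>) (E i))"
    proof (cases "pmf p n = 0")
      case True
      have "M.prob (D \<inter> F) \<le> M.prob D"
        by (rule M.finite_measure_mono[OF _ D]) auto
      then show ?thesis
        using True prob_D measure_nonneg[of M "D \<inter> F"] by simp
    next
      case False
      then have n: "n \<in> set_pmf p" by (simp add: set_pmf_iff)
      define N where "N = uniform_measure M D"
      have emD: "emeasure M D \<noteq> 0" "emeasure M D \<noteq> \<infinity>"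
        using False by (simp_all add: M.emeasure_eq_measure prob_D)
      interpret N: prob_space N
        unfolding N_def by (rule prob_space_uniform_measure[OF emD])
      have indep: "N.indep_vars (\<lambda>_. borel) (\<lambda>i \<omega>. subtree [i] (\<tau> \<omega>)) {1..n}"
        and law: "\<And>i. i \<in> {1..n} \<Longrightarrow> distr N borel (\<lambda>\<omega>. subtree [i] (\<tau> \<omega>)) = distr M borel \<tau>"
        using assms n by (auto simp: galton_watson_tree_def Let_def N_def D_def)
      have spN: "space N = space M" by (simp add: N_def)
      have marg: "N.prob ((\<lambda>\<omega>. subtree [i] (\<tau> \<omega>)) -` E i \<inter> space N) = measure (distr M borel \<tau>) (E i)"
        if i: "i \<in> {1..n}" for i
      proof -
        have "(\<lambda>\<omega>. subtree [i] (\<tau> \<omega>)) \<in> borel_measurable N"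
          using indep i unfolding N.indep_vars_def by blast
        then show ?thesis
          using measure_distr[of "\<lambda>\<omega>. subtree [i] (\<tau> \<omega>)" N borel "E i"] E law[OF i] by simp
      qed
      have "N.prob F = (\<Prod>i\<in>{1..n}. measure (distr M borel \<tau>) (E i))"
      proof (cases "n = 0")
        case True
        then show ?thesis
          using N.prob_space by (simp add: F_def spN)
      next
        case False
        have "F = (\<Inter>i\<in>{1..n}. (\<lambda>\<omega>. subtree [i] (\<tau> \<omega>)) -` E i \<inter> space N)"
          using False by (auto simp: F_def spN)
        then have "N.prob F = (\<Prod>i\<in>{1..n}. N.prob ((\<lambda>\<omega>. subtree [i] (\<tau> \<omega>)) -` E i \<inter> space N))"
          using N.indep_varsD_finite[OF indep, of E] False E by auto
        then show ?thesis
          using marg by simp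
      qed
      moreover have "N.prob F = M.prob (D \<inter> F) / M.prob D"
      proof -
        have "{\<omega> \<in> space M. subtree [i] (\<tau> \<omega>) \<in> E i} \<in> sets M" for i
        proof -
          have "(\<lambda>\<omega>. subtree [i] (\<tau> \<omega>)) \<in> borel_measurable M" by simp
          from measurable_sets[OF this E[of i]] show ?thesis
            by (simp add: vimage_def Int_def conj_commute)
        qed
        then have "F \<in> sets M"
          unfolding F_def by (intro sets.sets_Collect_finite_All) simp_all
        then show ?thesis
          unfolding N_def by (rule measure_uniform_measure[OF emD])
      qed
      ultimately show ?thesis
        using False prob_D by (simp add: field_simps)
    qed
    finally show "measure (distr M borel \<tau>) {t. out_degree [] t = n \<and> (\<forall>i\<in>{1..n}. subtree [i] t \<in> E i)} =
        pmf p n * (\<Prod>i\<in>{1..n}. measure (distr M borel \<tau>) (E i))" .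
  qed simp
qed

context branching_law
begin

lemma space_L [simp]: "space L = UNIV"
  using sets_eq_imp_space_eq[OF sets_L] by simp

text \<open>
  If \<open>t \<in> E\<close> says that the subtrees at all children of the root are in \<open>F\<close>, then the
  probability of \<open>E\<close> is the generating function of \<open>p\<close> at the probability of \<open>F\<close>.
\<close>
lemma sums_over_root_degree:
  assumes E: "E \<in> sets borel"
    and iff: "\<And>t. t \<in> E \<longleftrightarrow> (\<forall>i\<in>{1..out_degree [] t}. subtree [i] t \<in> F)"
    and F: "F \<in> sets borel"
  shows "(\<lambda>n. pmf p n * prob F ^ n) sums prob E"
proof -
  let ?A = "\<lambda>n. {t. out_degree [] t = n \<and> (\<forall>i\<in>{1..n}. subtree [i] t \<in> F)}"
  have "(\<lambda>n. prob (?A n)) sums prob (\<Union>n. ?A n)"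
    using root_branching_in_borel[of "\<lambda>_. F"] F
    by (intro finite_measure_UNION) (auto simp: sets_L disjoint_family_on_def)
  also have "(\<Union>n. ?A n) = E"
    using iff by auto
  also have "(\<lambda>n. prob (?A n)) = (\<lambda>n. pmf p n * prob F ^ n)"
    using branching[of "\<lambda>_. F"] F by simp
  finally show ?thesis .
qed

lemma prob_width_infinite:
  assumes p: "critical p"
  shows "prob {t. width t = \<infinity>} = 0"
proof -
  let ?F = "{t. width t < \<infinity>}"
  define r where "r = prob ?F"
  have r: "0 \<le> r" "r \<le> 1" by (simp_all add: r_def)
  obtain k where k: "k \<in> set_pmf p" "k \<ge> 2"
    using p by (rule critical_imp_ge2)
  \<comment> \<open>The excesses over Bernoulli's bound are nonnegative. They sum to \<open>r - (1 - (1 - r)) = 0\<close>,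
    because \<open>r\<close> is a fixed point of the generating function and \<open>p\<close> has mean \<open>1\<close>, so each
    of them vanishes.\<close>
  define d where "d n = pmf p n * (r ^ n - (1 - real n * (1 - r)))" for n
  have "(\<lambda>n. pmf p n * r ^ n) sums r"
    unfolding r_def
  proof (rule sums_over_root_degree)
    show "t \<in> ?F \<longleftrightarrow> (\<forall>i\<in>{1..out_degree [] t}. subtree [i] t \<in> ?F)" for t
      using width_finite_iff[of t] by simp
  qed (rule width_finite_in_borel)+
  moreover have "(\<lambda>n. pmf p n) sums 1"
    using sums_pmf_nat[of p "\<lambda>_. 1"] by simp
  ultimately have "(\<lambda>n. pmf p n * r ^ n - (pmf p n - pmf p n * real n * (1 - r))) sums (r - (1 - 1 * (1 - r)))"
    by (intro sums_diff sums_mult2 critical_sums p)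
  then have d: "d sums 0"
    unfolding d_def by (simp add: algebra_simps)
  have d_nonneg: "0 \<le> d n" for n
    using Bernoulli_inequality[of "r - 1" n] r(1) unfolding d_def
    by (intro mult_nonneg_nonneg) (auto simp: algebra_simps)
  have "d k = 0"
    using suminf_eq_zero_iff[OF sums_summable[OF d] d_nonneg] sums_unique[OF d] by simp
  then have "r ^ k = 1 - real k * (1 - r)"
    using k(1) by (simp add: d_def set_pmf_iff)
  then have "r = 1"
    by (rule Bernoulli_equality_imp_eq_1[OF r k(2)])
  moreover have "{t. width t = \<infinity>} = space L - ?F" by auto
  ultimately show ?thesis
    using prob_compl[of ?F] width_finite_in_borel by (simp only: sets_L r_def)
qed

lemma prob_width_gr_tendsto_0:
  assumes "critical p"
  shows "(\<lambda>n. prob {t. width t > enat n}) \<longlonglongrightarrow> 0"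
proof -
  have "(\<lambda>n. prob {t. width t > enat n}) \<longlonglongrightarrow> prob (\<Inter>n. {t. width t > enat n})"
    by (rule finite_Lim_measure_decseq)
      (auto simp: sets_L decseq_def intro: order_le_less_trans[rotated])
  also have "(\<Inter>n. {t. width t > enat n}) = {t. width t = \<infinity>}"
  proof (intro set_eqI)
    fix t show "t \<in> (\<Inter>n. {t. width t > enat n}) \<longleftrightarrow> t \<in> {t. width t = \<infinity>}"
      by (cases "width t") auto
  qed
  finally show ?thesis
    using prob_width_infinite[OF assms] by simp
qed

text \<open>
  With positive probability the root has \<open>k \<ge> 2\<close> children whose subtrees all have at least \<open>2\<^sup>h\<close>
  nodes at height \<open>h\<close>, and then there are at least \<open>2\<^sup>h\<^sup>+\<^sup>1\<close> nodes at height \<open>h + 1\<close>.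
\<close>
lemma prob_level_size_ge_pos:
  assumes k: "k \<in> set_pmf p" "k \<ge> 2"
  shows "prob {t. level_size h t \<ge> 2 ^ h} > 0"
proof (induction h)
  case 0
  then show ?case using prob_space by simp
next
  case (Suc h)
  let ?E = "{t. level_size h t \<ge> 2 ^ h}"
  have E: "?E \<in> sets borel" by (rule level_size_in_borel)
  have "0 < pmf p k * prob ?E ^ k"
    using Suc.IH k(1) by (simp add: pmf_positive)
  also have "\<dots> = prob {t. out_degree [] t = k \<and> (\<forall>i\<in>{1..k}. subtree [i] t \<in> ?E)}"
    using branching[of "\<lambda>_. ?E" k] E by simp
  also have "\<dots> \<le> prob {t. level_size (Suc h) t \<ge> 2 ^ Suc h}"
  proof (rule finite_measure_mono)
    show "{t. out_degree [] t = k \<and> (\<forall>i\<in>{1..k}. subtree [i] t \<in> ?E)} \<subseteq> {t. level_size (Suc h) t \<ge> 2 ^ Suc h}"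
    proof safe
      fix t assume t: "\<forall>i\<in>{1..out_degree [] t}. subtree [i] t \<in> ?E" and k': "k = out_degree [] t"
      have "2 ^ Suc h \<le> k * 2 ^ h" using k(2) by simp
      also have "\<dots> = (\<Sum>i\<in>{1..out_degree [] t}. 2 ^ h)" by (simp add: k')
      also have "\<dots> \<le> level_size (Suc h) t"
        unfolding level_size_Suc using t by (intro sum_mono) auto
      finally show "2 ^ Suc h \<le> level_size (Suc h) t" .
    qed
    show "{t. level_size (Suc h) t \<ge> 2 ^ Suc h} \<in> sets L"
      unfolding sets_L by (rule level_size_in_borel)
  qed
  finally show ?case .
qed

lemma prob_width_gr_pos:
  assumes k: "k \<in> set_pmf p" "k \<ge> 2"
  shows "prob {t. width t > enat n} > 0"
proof -
  have "0 < prob {t. level_size n t \<ge> 2 ^ n}"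
    by (rule prob_level_size_ge_pos[OF k])
  also have "\<dots> \<le> prob {t. width t > enat n}"
  proof (rule finite_measure_mono)
    show "{t. level_size n t \<ge> 2 ^ n} \<subseteq> {t. width t > enat n}"
    proof safe
      fix t assume "2 ^ n \<le> level_size n t"
      then have "n < level_size n t"
        using less_exp[of n] by linarith
      then show "enat n < width t"
        using level_size_le_width[of n t] by (metis enat_ord_simps(2) order_less_le_trans)
    qed
  qed (simp add: sets_L)
  finally show ?thesis .
qed

lemma prob_cell: "prob (cell h t) = weight p h t"
proof (induction h arbitrary: t)
  case 0
  have "cell 0 t = UNIV" using truncate_0 by (auto simp: cell_def)
  then show ?case using prob_space by simp
next
  case (Suc h)
  show ?case
    unfolding cell_Suc weight_Suc
    using branching[of "\<lambda>i. cell h (subtree [i] t)" "out_degree [] t"] by (simp add: Suc.IH)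
qed

text \<open>
  All subtrees rooted at the nodes at height \<open>h\<close> have width at most \<open>n\<close> if the whole tree does. The
  induction on \<open>h\<close> splits the tree at the root, so the independence of the subtrees at height \<open>h\<close>
  is not needed as a separate statement.
\<close>
lemma prob_cell_width_le:
  "prob (cell h t \<inter> {s. width s \<le> enat n}) \<le>
     weight p h t * prob {s. width s \<le> enat n} ^ level_size h t"
proof (induction h arbitrary: t)
  case 0
  have "cell 0 t = UNIV" using truncate_0 by (auto simp: cell_def)
  then show ?case by simp
next
  case (Suc h)
  let ?W = "{s. width s \<le> enat n}" and ?k = "out_degree [] t"
  let ?E = "\<lambda>i. cell h (subtree [i] t) \<inter> ?W"
  have "prob (cell (Suc h) t \<inter> ?W) \<le> prob {s. out_degree [] s = ?k \<and> (\<forall>i\<in>{1..?k}. subtree [i] s \<in> ?E i)}"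
  proof (rule finite_measure_mono)
    show "{s. out_degree [] s = ?k \<and> (\<forall>i\<in>{1..?k}. subtree [i] s \<in> ?E i)} \<in> sets L"
      unfolding sets_L by (rule root_branching_in_borel) simp
    show "cell (Suc h) t \<inter> ?W \<subseteq> {s. out_degree [] s = ?k \<and> (\<forall>i\<in>{1..?k}. subtree [i] s \<in> ?E i)}"
      proof
      fix s assume s: "s \<in> cell (Suc h) t \<inter> ?W"
      then have "width (subtree [i] s) \<le> enat n" if "i \<in> {1..?k}" for i
        using width_subtree_le[of i s] that order_trans unfolding cell_Suc by auto
      with s show "s \<in> {s. out_degree [] s = ?k \<and> (\<forall>i\<in>{1..?k}. subtree [i] s \<in> ?E i)}"
        unfolding cell_Suc by simp
    qed
  qed
  also have "\<dots> = pmf p ?k * (\<Prod>i\<in>{1..?k}. prob (?E i))"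
    using branching[of ?E ?k] by simp
  also have "\<dots> \<le> pmf p ?k * (\<Prod>i\<in>{1..?k}. weight p h (subtree [i] t) * prob ?W ^ level_size h (subtree [i] t))"
    by (intro mult_left_mono prod_mono conjI Suc.IH) simp_all
  also have "\<dots> = weight p (Suc h) t * prob ?W ^ level_size (Suc h) t"
    by (simp add: weight_Suc level_size_Suc prod.distrib power_sum)
  finally show ?case .
qed

lemma prob_cell_width_gr_ge:
  "prob (cell h t \<inter> {s. width s > enat n}) \<ge>
     weight p h t * (1 - (1 - prob {s. width s > enat n}) ^ level_size h t)"
proof -
  let ?W = "{s. width s \<le> enat n}" and ?V = "{s. width s > enat n}"
  have "?W = space L - ?V" by auto
  then have W: "prob ?W = 1 - prob ?V"
    using prob_compl[of ?V] by (simp add: sets_L)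
  have "cell h t \<inter> ?V = cell h t - (cell h t \<inter> ?W)" by auto
  then have "prob (cell h t \<inter> ?V) = prob (cell h t) - prob (cell h t \<inter> ?W)"
    using finite_measure_Diff[of "cell h t" "cell h t \<inter> ?W"] by (simp add: sets_L)
  then show ?thesis
    using prob_cell_width_le[of h t n] by (simp add: prob_cell W algebra_simps)
qed

end

section \<open>The immortal tree\<close>

lemma pmf_size_biased:
  assumes "critical p"
  shows "pmf (size_biased p) k = real k * pmf p k"
proof -
  have mean: "offspring_mean p = 1"
    using assms by (simp add: critical_def)
  have "(\<integral>\<^sup>+k. ennreal (real k * pmf p k / offspring_mean p) \<partial>count_space UNIV) = 1"
    unfolding nn_integral_count_space_nat mean
    by (subst suminf_ennreal_eq[where x = 1])
      (use critical_sums[OF assms] in \<open>simp_all add: mult.commute\<close>)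
  then show ?thesis
    unfolding size_biased_def by (subst pmf_embed_pmf) (simp_all add: mean)
qed

lemma measure_mark_normal: "measure (measure_pmf (mark_pmf p)) {m. fst m = k} = pmf p k"
proof -
  have "measure (measure_pmf (mark_pmf p)) {m. fst m = k} = measure (map_pmf fst (mark_pmf p)) {k}"
    by (simp add: vimage_def)
  also have "map_pmf fst (mark_pmf p) = p"
    unfolding mark_pmf_def by (rule map_fst_pair_pmf)
  finally show ?thesis by (simp add: measure_pmf_single)
qed

text \<open>
  The factor \<open>l\<close> of the size-biased distribution cancels against the probability \<open>1 / l\<close> of
  choosing the special child \<open>c\<close>, so a special node contributes to the weight of a tree in the same
  way as a normal one.
\<close>
lemma measure_mark_special:
  assumes p: "critical p" and c: "c \<in> {1..l}"
  shows "measure (measure_pmf (mark_pmf p)) {m. snd m = (l, c)} = pmf p l"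
proof -
  let ?U = "\<lambda>l. map_pmf (Pair l) (pmf_of_set {1..l})"
  have "measure (measure_pmf (mark_pmf p)) {m. snd m = (l, c)} = measure (map_pmf snd (mark_pmf p)) {(l, c)}"
    by (simp add: vimage_def)
  also have "map_pmf snd (mark_pmf p) = bind_pmf (size_biased p) ?U"
    unfolding mark_pmf_def by (rule map_snd_pair_pmf)
  also have "measure (measure_pmf (bind_pmf (size_biased p) ?U)) {(l, c)} =
      measure_pmf.expectation (size_biased p) (\<lambda>x. pmf (?U x) (l, c))"
    by (simp add: measure_pmf_single pmf_bind)
  also have "\<dots> = measure_pmf.expectation (size_biased p) (\<lambda>x. indicator {l} x * (1 / real l))"
  proof (rule Bochner_Integration.integral_cong[OF refl])
    fix x
    show "pmf (?U x) (l, c) = indicator {l} x * (1 / real l)"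
    proof (cases "x = l")
      case True
      have "pmf (?U l) (l, c) = pmf (pmf_of_set {1..l}) c"
        by (rule pmf_map_inj') (simp add: inj_on_def)
      then show ?thesis
        using c True by simp
    next
      case False
      then have "(l, c) \<notin> set_pmf (?U x)" by auto
      then have "pmf (?U x) (l, c) = 0" by (simp only: set_pmf_iff not_not)
      then show ?thesis using False by simp
    qed
  qed
  also have "\<dots> = pmf (size_biased p) l * (1 / real l)"
    by (simp add: measure_pmf_single)
  also have "\<dots> = pmf p l"
    using c by (simp add: pmf_size_biased[OF p])
  finally show ?thesis .
qed

lemma set_mark_pmf_special:
  assumes p: "critical p" and m: "m \<in> set_pmf (mark_pmf p)"
  shows "snd (snd m) \<in> {1..fst (snd m)}"
proof -
  have "snd m \<in> set_pmf (map_pmf snd (mark_pmf p))"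
    using m by simp
  also have "map_pmf snd (mark_pmf p) = bind_pmf (size_biased p) (\<lambda>l. map_pmf (Pair l) (pmf_of_set {1..l}))"
    unfolding mark_pmf_def by (rule map_snd_pair_pmf)
  finally obtain l where l: "l \<in> set_pmf (size_biased p)" "snd m \<in> Pair l ` set_pmf (pmf_of_set {1..l})"
    by auto
  have "l \<noteq> 0"
    using l(1) by (auto simp: set_pmf_iff pmf_size_biased[OF p])
  then have "set_pmf (pmf_of_set {1..l}) = {1..l}"
    by (intro set_pmf_of_set) auto
  with l(2) show ?thesis by auto
qed

lemma nodes_marked_tree: "u \<in> nodes (marked_tree m) \<longleftrightarrow> (\<exists>x. has_type m u x)"
  by (simp add: marked_tree.rep_eq)

lemma out_degree_marked_tree:
  assumes "has_type m u x"
  shows "out_degree u (marked_tree m) = (case x of Normal \<Rightarrow> fst (m u) | Special \<Rightarrow> fst (snd (m u)))"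
proof (rule out_degree_eqI)
  fix i
  have "has_type m u y \<longleftrightarrow> y = x" for y
    using has_type_unique assms by blast
  then show "u @ [i] \<in> nodes (marked_tree m) \<longleftrightarrow>
      1 \<le> i \<and> i \<le> (case x of Normal \<Rightarrow> fst (m u) | Special \<Rightarrow> fst (snd (m u)))"
    by (cases x) (auto simp: nodes_marked_tree has_type_snoc)
qed

lemma special_take:
  assumes "has_type m u Special" "j < length u"
  shows "has_type m (take j u) Special \<and> snd (snd (m (take j u))) = u ! j"
  using assms
proof (induction u arbitrary: j rule: rev_induct)
  case (snoc i u)
  then have u: "has_type m u Special" "i = snd (snd (m u))"
    by (auto simp: has_type_snoc split: if_splits)
  show ?case
  proof (cases "j = length u")
    case True
    then show ?thesis using u by simp
  next
    case False
    then have "j < length u" using snoc.prems(2) by simp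
    then show ?thesis using snoc.IH[OF u(1)] by (simp add: nth_append)
  qed
qed simp

lemma special_unique:
  assumes "has_type m u Special" "has_type m v Special" "length u = length v"
  shows "u = v"
  using assms
proof (induction u arbitrary: v rule: rev_induct)
  case (snoc i u)
  then obtain w j where v: "v = w @ [j]"
    by (cases v rule: rev_cases) auto
  have "has_type m u Special" "i = snd (snd (m u))" "has_type m w Special" "j = snd (snd (m w))"
    using snoc.prems by (auto simp: v has_type_snoc split: if_splits)
  moreover from this have "u = w"
    using snoc.IH[of w] snoc.prems v by simp
  ultimately show ?case by (simp add: v)
qed simp

lemma special_exists:
  assumes "\<And>u. snd (snd (m u)) \<in> {1..fst (snd (m u))}"
  shows "\<exists>u. length u = h \<and> has_type m u Special"
proof (induction h)
  case 0
  then show ?case using has_type.root by auto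
next
  case (Suc h)
  then obtain u where u: "length u = h" "has_type m u Special" by blast
  have "has_type m (u @ [snd (snd (m u))]) Special"
    using u(2) assms[of u] by (simp add: has_type_snoc)
  with u(1) show ?case by (intro exI[of _ "u @ [snd (snd (m u))]"]) simp
qed

text \<open>
  The marks allowed at the node \<open>v\<close> if the marked tree agrees with \<open>t\<close> and \<open>u\<close> is special, where
  \<open>v\<close> is shorter than \<open>u\<close>: proper prefixes of \<open>u\<close> are special and must select the next letter of
  \<open>u\<close>, and the other nodes are normal. Only the part of the mark belonging to the type of \<open>v\<close> is
  constrained.
\<close>
definition spine_marks :: "tree \<Rightarrow> nat list \<Rightarrow> nat list \<Rightarrow> (nat \<times> nat \<times> nat) set" where
  "spine_marks t u v =
     (if v = take (length v) u then {m. snd m = (out_degree v t, u ! length v)}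
      else {m. fst m = out_degree v t})"

text \<open>
  The choice \<open>c\<close> in each mark is assumed to be a valid child number, which holds almost surely;
  otherwise the line of special nodes could end below height \<open>h\<close>.
\<close>
lemma marks_spine:
  assumes m: "\<And>u. snd (snd (m u)) \<in> {1..fst (snd (m u))}"
    and cell: "marked_tree m \<in> cell h t"
  shows "\<exists>u\<in>{u \<in> nodes t. length u = h}. \<forall>v\<in>{v \<in> nodes t. length v < h}. m v \<in> spine_marks t u v"
proof -
  obtain u where u: "length u = h" "has_type m u Special"
    using special_exists[of m] m by blast
  have iff: "v \<in> nodes t \<longleftrightarrow> (\<exists>x. has_type m v x)" if "length v \<le> h" for v
    using cell that nodes_marked_tree by (auto simp: cell_def truncate_eq_iff)
  have "m v \<in> spine_marks t u v" if v: "v \<in> nodes t" "length v < h" for v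
  proof -
    obtain x where x: "has_type m v x"
      using iff[of v] v by auto
    have deg: "out_degree v t = (case x of Normal \<Rightarrow> fst (m v) | Special \<Rightarrow> fst (snd (m v)))"
      using out_degree_truncate_cong[of h "marked_tree m" t v] cell v(2) out_degree_marked_tree[OF x]
      by (simp add: cell_def)
    have sp: "has_type m (take (length v) u) Special" "snd (snd (m (take (length v) u))) = u ! length v"
      using special_take[OF u(2), of "length v"] v(2) u(1) by auto
    show ?thesis
    proof (cases "v = take (length v) u")
      case True
      then have "has_type m v Special" using sp(1) by simp
      then have "x = Special" using x has_type_unique by blast
      then show ?thesis
        using True deg sp(2) by (auto simp: spine_marks_def prod_eq_iff)
    next
      case False
      then have "\<not> has_type m v Special"
        using special_unique[OF _ sp(1)] v(2) u(1) by auto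
      then have "x = Normal" using x by (cases x) auto
      then show ?thesis
        using False deg by (simp add: spine_marks_def)
    qed
  qed
  moreover have "u \<in> nodes t" using iff[of u] u by auto
  ultimately show ?thesis using u(1) by blast
qed

text \<open>The law of the independent marks from which the immortal tree is built.\<close>
abbreviation marks_law :: "nat pmf \<Rightarrow> (nat list \<Rightarrow> nat \<times> nat \<times> nat) measure" where
  "marks_law p \<equiv> PiM UNIV (\<lambda>_. measure_pmf (mark_pmf p))"

lemma component_pred:
  "Measurable.pred (marks_law p) (\<lambda>m. P (m u))"
proof -
  have "(\<lambda>m. m u) \<in> measurable (marks_law p) (measure_pmf (mark_pmf p))"
    by (rule measurable_component_singleton) simp
  then show ?thesis
    by (rule measurable_compose) simp
qed

lemma has_type_measurable: "Measurable.pred (marks_law p) (\<lambda>m. has_type m u x)"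
proof (induction u arbitrary: x rule: rev_induct)
  case Nil
  have "has_type m [] x \<longleftrightarrow> x = Special" for m
    using has_type.root[of m] has_type_unique[of m "[]"] by blast
  then show ?case by simp
next
  case (snoc i u)
  show ?case
    unfolding has_type_snoc by (intro pred_intros_logic snoc.IH component_pred[where P = "\<lambda>m. i \<le> fst m"]
      component_pred[where P = "\<lambda>m. i \<le> fst (snd m)"] component_pred[where P = "\<lambda>m. x = (if i = snd (snd m) then Special else Normal)"]) simp_all
qed

lemma marked_tree_measurable: "marked_tree \<in> borel_measurable (marks_law p)"
proof (rule measurable_treeI)
  fix h t
  have "marked_tree -` cell h t \<inter> space (marks_law p) =
    {m \<in> space (marks_law p). \<forall>u. length u \<le> h \<longrightarrow> ((has_type m u Normal \<or> has_type m u Special) \<longleftrightarrow> u \<in> nodes t)}"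
  proof -
    have "(\<exists>x. has_type m u x) \<longleftrightarrow> has_type m u Normal \<or> has_type m u Special" for m u
      by (metis node_type.exhaust)
    then show ?thesis
      by (auto simp: cell_def truncate_eq_iff nodes_marked_tree)
  qed
  also have "\<dots> \<in> sets (marks_law p)"
    by (intro predE pred_intros_countable pred_intros_logic has_type_measurable)
      simp_all
  finally show "marked_tree -` cell h t \<inter> space (marks_law p) \<in> sets (marks_law p)" .
qed

lemma emeasure_spine_marks:
  assumes p: "critical p" and u: "u \<in> nodes t" "length u = h" and v: "length v < h"
  shows "emeasure (measure_pmf (mark_pmf p)) (spine_marks t u v) = ennreal (pmf p (out_degree v t))"
proof (cases "v = take (length v) u")
  case True
  have "take (Suc (length v)) u = v @ [u ! length v]"
    using True u(2) v by (metis take_Suc_conv_app_nth)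
  moreover have "take (Suc (length v)) u \<in> nodes t"
    by (rule nodes_prefix[of _ "drop (Suc (length v)) u"]) (simp add: u(1))
  ultimately have "v @ [u ! length v] \<in> nodes t" by simp
  then have "u ! length v \<in> {1..out_degree v t}"
    using child_in_nodes_iff[of v t] nodes_prefix[of v] by auto
  then show ?thesis
    using True measure_mark_special[OF p]
    by (simp add: spine_marks_def measure_pmf.emeasure_eq_measure)
next
  case False
  then show ?thesis
    by (simp add: spine_marks_def measure_pmf.emeasure_eq_measure measure_mark_normal)
qed

text \<open>
  Up to a null set, the cell is the union over the nodes \<open>u\<close> of \<open>t\<close> at height \<open>h\<close> of the events
  that the marks fit \<open>t\<close> with \<open>u\<close> special. These events are in fact disjoint, so equality holds,
  but the union bound is enough.
\<close>
lemma emeasure_immortal_cell_le: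
  assumes p: "critical p"
  shows "emeasure (immortal_law p) (cell h t) \<le>
    of_nat (level_size h t) * ennreal (weight p h t)"
proof -
  let ?M = "marks_law p" and ?J = "{u \<in> nodes t. length u < h}" and ?S = "{u \<in> nodes t. length u = h}"
  interpret product_prob_space "\<lambda>_. measure_pmf (mark_pmf p)" UNIV
    by standard
  let ?A = "\<lambda>u. {m \<in> space ?M. \<forall>v\<in>?J. m v \<in> spine_marks t u v}"
  have A: "?A u \<in> sets ?M" for u
    by (intro sets.sets_Collect_finite_All predE finite_nodes_less
        component_pred[where P = "\<lambda>x. x \<in> spine_marks t u v" for v])
  have ae: "AE m in ?M. \<forall>u. snd (snd (m u)) \<in> {1..fst (snd (m u))}"
  proof (subst AE_all_countable, rule allI)
    fix u :: "nat list"
    show "AE m in ?M. snd (snd (m u)) \<in> {1..fst (snd (m u))}"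
    proof (rule AE_PiM_component[where P = "\<lambda>x. snd (snd x) \<in> {1..fst (snd x)}"])
      show "AE x in measure_pmf (mark_pmf p). snd (snd x) \<in> {1..fst (snd x)}"
        using set_mark_pmf_special[OF p] by (simp only: AE_measure_pmf_iff) blast
    qed (simp_all add: prob_space_measure_pmf)
  qed
  have "emeasure (immortal_law p) (cell h t) = emeasure ?M (marked_tree -` cell h t \<inter> space ?M)"
    unfolding immortal_law_def by (rule emeasure_distr[OF marked_tree_measurable]) simp
  also have "\<dots> \<le> emeasure ?M (\<Union>u\<in>?S. ?A u)"
  proof (rule emeasure_mono_AE)
    show "AE m in ?M. m \<in> marked_tree -` cell h t \<inter> space ?M \<longrightarrow> m \<in> (\<Union>u\<in>?S. ?A u)"
      using ae
    proof eventually_elim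
      case (elim m)
      show ?case
      proof
        assume m: "m \<in> marked_tree -` cell h t \<inter> space ?M"
        then have "\<exists>u\<in>?S. \<forall>v\<in>?J. m v \<in> spine_marks t u v"
          using elim by (intro marks_spine) simp_all
        with m show "m \<in> (\<Union>u\<in>?S. ?A u)" by simp
      qed
    qed
    show "(\<Union>u\<in>?S. ?A u) \<in> sets ?M"
      using A finite_level by (intro sets.finite_UN) auto
  qed
  also have "\<dots> \<le> (\<Sum>u\<in>?S. emeasure ?M (?A u))"
    using A finite_level by (intro emeasure_subadditive_finite) auto
  also have "\<dots> = (\<Sum>u\<in>?S. ennreal (\<Prod>v\<in>?J. pmf p (out_degree v t)))"
  proof (rule sum.cong[OF refl])
    fix u assume u: "u \<in> ?S"
    have "emeasure ?M (?A u) = (\<Prod>v\<in>?J. emeasure (measure_pmf (mark_pmf p)) (spine_marks t u v))"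
      by (rule emeasure_PiM_Collect) (simp_all add: finite_nodes_less)
    also have "\<dots> = (\<Prod>v\<in>?J. ennreal (pmf p (out_degree v t)))"
      using u by (intro prod.cong refl emeasure_spine_marks[OF p]) auto
    also have "\<dots> = ennreal (\<Prod>v\<in>?J. pmf p (out_degree v t))"
      by (rule prod_ennreal) simp
    finally show "emeasure ?M (?A u) = ennreal (\<Prod>v\<in>?J. pmf p (out_degree v t))" .
  qed
  also have "\<dots> = of_nat (level_size h t) * ennreal (weight p h t)"
    by (simp add: level_size_def weight_def)
  finally show ?thesis .
qed

section \<open>Conditioning on a large width\<close>

lemma distr_uniform_measure:
  assumes X: "X \<in> measurable M N" and B: "B \<in> sets N"
  shows "distr (uniform_measure M (X -` B \<inter> space M)) N X = uniform_measure (distr M N X) B"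
proof (rule measure_eqI)
  fix A assume "A \<in> sets (distr (uniform_measure M (X -` B \<inter> space M)) N X)"
  then have A: "A \<in> sets N" by simp
  have "X -` (B \<inter> A) \<inter> space M = (X -` B \<inter> space M) \<inter> (X -` A \<inter> space M)" by auto
  then show "emeasure (distr (uniform_measure M (X -` B \<inter> space M)) N X) A =
      emeasure (uniform_measure (distr M N X) B) A"
    using X A B by (simp add: emeasure_distr measurable_sets)
qed simp

lemma (in branching_law) converges_in_law_immortal:
  assumes p: "critical p"
  shows "converges_in_law (\<lambda>n. uniform_measure L {t. width t > enat n}) (immortal_law p)"
proof (rule converges_in_law_if_cells)
  define v where "v n = prob {t. width t > enat n}" for n
  have V: "{t. width t > enat n} \<in> sets L" for n
    by (simp add: sets_L)
  obtain k where k: "k \<in> set_pmf p" "k \<ge> 2"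
    using p by (rule critical_imp_ge2)
  have v_pos: "v n > 0" for n
    unfolding v_def by (rule prob_width_gr_pos[OF k])
  have v_0: "v \<longlonglongrightarrow> 0"
    unfolding v_def by (rule prob_width_gr_tendsto_0[OF p])
  show "prob_space (uniform_measure L {t. width t > enat n})" for n
    using v_pos[of n] by (intro prob_space_uniform_measure) (simp_all add: emeasure_eq_measure v_def)
  show "sets (uniform_measure L {t. width t > enat n}) = sets borel" for n
    by (simp add: sets_L)
  show "prob_space (immortal_law p)"
    unfolding immortal_law_def
    by (intro prob_space.prob_space_distr prob_space_PiM marked_tree_measurable prob_space_measure_pmf)
  show "sets (immortal_law p) = sets borel"
    by (simp add: immortal_law_def)
  fix h t
  let ?Y = "level_size h t" and ?w = "weight p h t"
  let ?a = "\<lambda>n. ?w * ((1 - (1 - v n) ^ ?Y) / v n)"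
  have "?a \<longlonglongrightarrow> ?w * real ?Y"
    by (intro tendsto_mult tendsto_const tendsto_geometric_quotient v_0 v_pos)
  then have "(\<lambda>n. ennreal (?a n)) \<longlonglongrightarrow> ennreal (?w * real ?Y)"
    by (rule tendsto_ennrealI)
  then have "ennreal (?w * real ?Y) = liminf (\<lambda>n. ennreal (?a n))"
    by (intro lim_imp_Liminf[symmetric]) simp_all
  also have "\<dots> \<le> liminf (\<lambda>n. emeasure (uniform_measure L {t. width t > enat n}) (cell h t))"
  proof (intro Liminf_mono always_eventually allI)
    fix n
    have "?a n \<le> prob (cell h t \<inter> {s. width s > enat n}) / v n"
      using prob_cell_width_gr_ge[of h t n] v_pos[of n]
      by (simp add: v_def divide_right_mono)
    also have "ennreal \<dots> = emeasure (uniform_measure L {t. width t > enat n}) (cell h t)"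
      using v_pos[of n] V
      by (simp add: emeasure_uniform_measure emeasure_eq_measure sets_L divide_ennreal v_def Int_commute)
    finally show "ennreal (?a n) \<le> emeasure (uniform_measure L {t. width t > enat n}) (cell h t)"
      by (simp add: ennreal_leI)
  qed
  finally have "ennreal (?w * real ?Y) \<le> liminf (\<lambda>n. emeasure (uniform_measure L {t. width t > enat n}) (cell h t))" .
  moreover have "of_nat ?Y * ennreal ?w = ennreal (?w * real ?Y)"
    by (simp add: ennreal_mult' weight_nonneg mult.commute ennreal_of_nat_eq_real_of_nat)
  ultimately show "emeasure (immortal_law p) (cell h t) \<le>
      liminf (\<lambda>n. emeasure (uniform_measure L {t. width t > enat n}) (cell h t))"
    using emeasure_immortal_cell_le[OF p, of h t] by (simp only: order_trans)
qed

theorem corollary2p2: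
  fixes p :: "nat pmf" and M :: "'w measure" and \<tau> :: "'w \<Rightarrow> tree"
  assumes "critical p"
    and "galton_watson_tree p M \<tau>"
  shows "converges_in_law
           (\<lambda>n. distr (uniform_measure M {\<omega> \<in> space M. width (\<tau> \<omega>) > enat n}) borel \<tau>)
           (immortal_law p)"
proof -
  have \<tau>: "\<tau> \<in> borel_measurable M"
    using assms(2) by (simp add: galton_watson_tree_def)
  have eq: "distr (uniform_measure M {\<omega> \<in> space M. width (\<tau> \<omega>) > enat n}) borel \<tau> =
      uniform_measure (distr M borel \<tau>) {t. width t > enat n}" for n
  proof -
    have "{\<omega> \<in> space M. width (\<tau> \<omega>) > enat n} = \<tau> -` {t. width t > enat n} \<inter> space M"
      by auto
    then show ?thesis
      using distr_uniform_measure[OF \<tau> width_gr_in_borel[of n]] by simp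
  qed
  show ?thesis
    unfolding eq
    by (rule branching_law.converges_in_law_immortal[OF branching_law_galton_watson[OF assms(2)] assms(1)])
qed

end
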